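(* Let $\vartheta\in(0,\pi/2]$ and let $V\subset\mathbb{R}^2$ be the closed convex angle with vertex at the origin, of measure $\pi-2\vartheta$, bisected by the negative part of the $x$-axis (a ray if $\vartheta=\pi/2$). A set $A\in\mathcal{C}_V(\mathbb{R}^2)$ is a summand of $B\in\mathcal{C}_V(\mathbb{R}^2)$ if and only if the function $f_B-f_A$ is non-decreasing on $(-\vartheta,\vartheta)$.
   Context: $\mathcal{C}_V(\mathbb{R}^2)$ is the family of all nonempty closed convex sets $A\subset\mathbb{R}^2$ whose recession cone $\{x\mid x+A\subset A\}$ equals $V$. $A$ is a summand of $B$ if $B=A+C$ (Minkowski sum) for some nonempty closed convex set $C$. For $u\in\mathbb{R}^2$ the support set is $A(u)=\{a\in A\mid\langle u,a\rangle=\max_{b\in A}\langle u,b\rangle\}$. For $A\in\mathcal{C}_V(\mathbb{R}^2)$ and $t\in(-\vartheta,\vartheta)$, $H_A(t)$ is the center of $A(\cos t,\sin t)$, which is a segment or a singleton. The arc-length function $f_A:(-\vartheta,\vartheta)\to\mathbb{R}$ is defined as follows: for $t\geqslant0$, $f_A(t)$ is the length of the arc contained in the boundary of $A$ joining $H_A(0)$ and $H_A(t)$; for $t<0$, $f_A(t)$ is minus the length of the arc of the boundary joining $H_A(0)$ and $H_A(t)$. *)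

theory Defs
  imports "HOL-Analysis.Analysis"
begin

definition recession_cone :: "(real^2) set \<Rightarrow> (real^2) set" where
  "recession_cone A = {x. (\<lambda>a. x + a) ` A \<subseteq> A}"

definition convex_sets_rec :: "(real^2) set \<Rightarrow> (real^2) set set" where
  "convex_sets_rec V = {A. A \<noteq> {} \<and> closed A \<and> convex A \<and> recession_cone A = V}"

definition is_summand :: "(real^2) set \<Rightarrow> (real^2) set \<Rightarrow> bool" where
  "is_summand A B \<longleftrightarrow> (\<exists>C. C \<noteq> {} \<and> closed C \<and> convex C \<and> B = A + C)"

definition direction :: "real \<Rightarrow> real^2" where
  "direction t = vector [cos t, sin t]"

(* The angle of measure pi - 2 th bisected by the negative x-axis consists of the
   points with polar angle at distance at most pi/2 - th from pi, and the origin. *)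
definition left_angle :: "real \<Rightarrow> (real^2) set" where
  "left_angle \<theta> = {r *\<^sub>R direction \<phi> | r \<phi>. 0 \<le> r \<and> \<bar>\<phi> - pi\<bar> \<le> pi / 2 - \<theta>}"

definition support_set :: "(real^2) set \<Rightarrow> real^2 \<Rightarrow> (real^2) set" where
  "support_set A u = {a \<in> A. \<forall>b\<in>A. u \<bullet> b \<le> u \<bullet> a}"

(* Meaningful for a closed segment, possibly reduced to a point. *)
definition segment_center :: "(real^2) set \<Rightarrow> real^2" where
  "segment_center S = (THE c. \<exists>p q. S = closed_segment p q \<and> c = midpoint p q)"

definition support_center :: "(real^2) set \<Rightarrow> real \<Rightarrow> real^2" where
  "support_center A t = segment_center (support_set A (direction t))"

(* Supremum of the lengths of inscribed polygonal lines. The real supremum is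
   meaningful for rectifiable paths; arcs in the boundary of a planar convex set
   are always rectifiable. *)
definition path_length :: "(real \<Rightarrow> real^2) \<Rightarrow> real" where
  "path_length g = Sup {\<Sum>i<n. dist (g (s i)) (g (s (Suc i))) | (n::nat) s.
     mono_on {..n} s \<and> s ` {..n} \<subseteq> {0..1}}"

(* A library arc is injective and hence joins distinct points, so the degenerate arc
   from a point to itself is treated separately. The sets A considered here are unbounded
   and contain no line, so two points of the boundary are joined by exactly one arc in it
   (up to parametrization, which does not affect the length). *)
definition boundary_arc_length :: "(real^2) set \<Rightarrow> real^2 \<Rightarrow> real^2 \<Rightarrow> real" where
  "boundary_arc_length A p q =
     (if p = q then 0
      else THE l. \<exists>g. arc g \<and> path_image g \<subseteq> frontier A \<and>
                      pathstart g = p \<and> pathfinish g = q \<and> l = path_length g)"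

definition arc_length_function :: "(real^2) set \<Rightarrow> real \<Rightarrow> real" where
  "arc_length_function A t =
     (if 0 \<le> t then boundary_arc_length A (support_center A 0) (support_center A t)
      else - boundary_arc_length A (support_center A 0) (support_center A t))"

end

theory Submission
  imports Defs
begin

text \<open>
Write \<open>H\<^sub>A t\<close> for the support center and \<open>f\<^sub>A\<close> for the arc-length function of \<open>A\<close>. The idea is that
\<open>H\<^sub>A\<close> moves along the boundary with unit speed with respect to \<open>f\<^sub>A\<close>, that is
\<open>d H\<^sub>A = \<tau> d f\<^sub>A\<close> with the tangent \<open>\<tau> t = (- sin t, cos t)\<close>. So for \<open>G = H\<^sub>B - H\<^sub>A\<close> one has
\<open>d G = \<tau> d (f\<^sub>B - f\<^sub>A)\<close>, and \<open>f\<^sub>B - f\<^sub>A\<close> is non-decreasing if and only if \<open>G\<close> moves forwards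
along the tangents, as the support points of a convex set do.

If \<open>B = A + C\<close>, then \<open>G t\<close> is a support point of \<open>C\<close> in direction \<open>t\<close>
(\<open>support_center_diff_in_summand\<close>), so \<open>G\<close> moves forwards and \<open>f\<^sub>B - f\<^sub>A\<close> is non-decreasing
(\<open>summand_imp_mono_arc_length_diff\<close>). Conversely, if \<open>f\<^sub>B - f\<^sub>A\<close> is non-decreasing, the functional
\<open>direction T\<close> is maximal along \<open>G\<close> at \<open>T\<close> (\<open>support_center_diff_maximal\<close>). Since \<open>B\<close> is determined by
its supporting lines with angle in the open interval (\<open>separating_direction\<close>), this puts all \<open>G T\<close>
into \<open>C = {x. x + A \<subseteq> B}\<close>, and then \<open>A + C\<close>, which is closed because \<open>A\<close> has bounded superlevel sets
in direction \<open>0\<close>, has the same supporting lines as \<open>B\<close>.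

The differential relation is used in the integrated form of \<open>support_center_increment\<close>, with an error
of relative order \<open>t - s\<close>; such errors disappear when summed over fine partitions
(\<open>mono_from_small_errors\<close>). It rests on an identification of the boundary arcs: the boundary
between two support centers is a Lipschitz graph over the vertical axis, every arc in
the frontier between them runs through exactly this piece (\<open>boundary_arc_on_graph\<close>), and its length is the
variation of the graph (\<open>path_length_boundary_arc\<close>), which is additive and comparable to
tangential increments (\<open>cone_inner_tangent\<close>).
\<close>

section \<open>Directions and planar cones\<close>

lemma inner_real2: "x \<bullet> y = x $ 1 * y $ 1 + x $ 2 * y $ 2" for x y :: "real^2"
  by (simp add: inner_vec_def sum_2)

lemma direction_nth [simp]: "direction t $ 1 = cos t" "direction t $ 2 = sin t"
  by (simp_all add: direction_def)

lemma inner_direction: "direction s \<bullet> direction t = cos (s - t)"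
  by (simp add: inner_real2 cos_diff)

lemma norm_direction [simp]: "norm (direction t) = 1"
  by (simp add: norm_eq_1 inner_direction)

abbreviation tangent :: "real \<Rightarrow> real^2" where
  "tangent t \<equiv> direction (t + pi / 2)"

lemma tangent_nth: "tangent t $ 1 = - sin t" "tangent t $ 2 = cos t"
  by (simp_all add: cos_add sin_add)

lemma direction_tangent_decomposition:
  "x = (direction t \<bullet> x) *\<^sub>R direction t + (tangent t \<bullet> x) *\<^sub>R tangent t"
proof -
  have "x $ 1 = (cos t * x $ 1 + sin t * x $ 2) * cos t - (cos t * x $ 2 - sin t * x $ 1) * sin t"
    "x $ 2 = (cos t * x $ 1 + sin t * x $ 2) * sin t + (cos t * x $ 2 - sin t * x $ 1) * cos t"
    using sin_cos_squared_add[of t] by algebra+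
  then show ?thesis
    by (simp add: vec_eq_iff forall_2 inner_real2 tangent_nth algebra_simps del: direction_nth)
       (simp add: cos_add sin_add algebra_simps)
qed

text \<open>
A vector that points backwards with respect to the normal at angle \<open>s\<close> and forwards with respect
to the one at angle \<open>t\<close> is a nonnegative combination of the two tangents, and \<open>c\<close> bounds from
below the cosines of their angles with the tangent at \<open>m\<close>. Increments along a convex curve between two of its support points are of
this kind, and this estimate is what makes their lengths comparable to linear functionals.
\<close>

lemma cone_inner_tangent:
  assumes "direction s \<bullet> x \<le> 0" "0 \<le> direction t \<bullet> x" "s < t" "t < s + pi"
    and "0 \<le> c" "c \<le> cos (m - s)" "c \<le> cos (t - m)"
  shows "c * norm x \<le> tangent m \<bullet> x"
proof -
  define S where "S = sin (t - s)"
  \<comment> \<open>the coordinates of \<open>x\<close> in the basis of the two tangents\<close>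
  define a b where "a = (direction t \<bullet> x) / S" and "b = - (direction s \<bullet> x) / S"
  have "0 < S"
    unfolding S_def using assms by (intro sin_gt_zero) auto
  then have "0 \<le> a" "0 \<le> b"
    using assms by (auto simp: a_def b_def divide_nonpos_pos)
  have aS: "a * S = cos t * x $ 1 + sin t * x $ 2" and bS: "b * S = - (cos s * x $ 1 + sin s * x $ 2)"
    and S: "S = sin t * cos s - cos t * sin s"
    using \<open>0 < S\<close> by (simp_all add: a_def b_def inner_real2) (simp add: S_def sin_diff)
  have "S * x $ 1 = S * (- a * sin s - b * sin t)" "S * x $ 2 = S * (a * cos s + b * cos t)"
    using aS bS S by algebra+
  then have x: "x = a *\<^sub>R tangent s + b *\<^sub>R tangent t"
    using \<open>0 < S\<close> by (simp add: vec_eq_iff forall_2 tangent_nth del: direction_nth)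
  have "norm x \<le> a + b"
    using \<open>0 \<le> a\<close> \<open>0 \<le> b\<close> norm_triangle_ineq[of "a *\<^sub>R tangent s" "b *\<^sub>R tangent t"]
    by (simp flip: x)
  then have "c * norm x \<le> a * c + b * c"
    using \<open>0 \<le> c\<close> mult_left_mono[of "norm x" "a + b" c] by (simp add: algebra_simps)
  also have "\<dots> \<le> a * cos (m - s) + b * cos (t - m)"
    using assms \<open>0 \<le> a\<close> \<open>0 \<le> b\<close> by (intro add_mono mult_left_mono) auto
  also have "\<dots> = tangent m \<bullet> x"
    by (subst x) (simp add: inner_add_right inner_direction cos_diff mult.commute)
  finally show ?thesis .
qed

section \<open>Variation and path length\<close>

definition variation :: "(real \<Rightarrow> 'a::metric_space) \<Rightarrow> real \<Rightarrow> real \<Rightarrow> real" where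
  "variation g a b = Sup {\<Sum>i<n. dist (g (s i)) (g (s (Suc i))) | (n::nat) s.
     mono_on {..n} s \<and> s ` {..n} \<subseteq> {a..b}}"

lemma path_length_eq_variation: "path_length g = variation g 0 1"
  by (simp add: path_length_def variation_def)

text \<open>
The supremum that defines the variation is unspecified for unbounded sets of reals, so its
boundedness is kept as a separate predicate.
\<close>

definition bounded_variation :: "(real \<Rightarrow> 'a::metric_space) \<Rightarrow> real \<Rightarrow> real \<Rightarrow> bool" where
  "bounded_variation g a b \<longleftrightarrow> (\<exists>M. \<forall>(n::nat) s. mono_on {..n} s \<longrightarrow> s ` {..n} \<subseteq> {a..b} \<longrightarrow>
     (\<Sum>i<n. dist (g (s i)) (g (s (Suc i)))) \<le> M)"

lemma sum_dist_le_variation: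
  assumes "bounded_variation g a b" "mono_on {..n} s" "s ` {..n} \<subseteq> {a..b}"
  shows "(\<Sum>i<n. dist (g (s i)) (g (s (Suc i)))) \<le> variation g a b"
  unfolding variation_def
proof (rule cSup_upper)
  show "bdd_above {\<Sum>i<n. dist (g (s i)) (g (s (Suc i))) | (n::nat) s.
     mono_on {..n} s \<and> s ` {..n} \<subseteq> {a..b}}"
    using assms(1) unfolding bounded_variation_def bdd_above_def by blast
qed (use assms in blast)

lemma variation_le:
  assumes "a \<le> b"
    and "\<And>(n::nat) s. mono_on {..n} s \<Longrightarrow> s ` {..n} \<subseteq> {a..b} \<Longrightarrow>
       (\<Sum>i<n. dist (g (s i)) (g (s (Suc i)))) \<le> M"
  shows "variation g a b \<le> M"
  unfolding variation_def
proof (rule cSup_least)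
  have "mono_on {..0::nat} (\<lambda>_. a)" "(\<lambda>_. a) ` {..0::nat} \<subseteq> {a..b}"
    using \<open>a \<le> b\<close> by (auto simp: monotone_on_def)
  then show "{\<Sum>i<n. dist (g (s i)) (g (s (Suc i))) | (n::nat) s.
     mono_on {..n} s \<and> s ` {..n} \<subseteq> {a..b}} \<noteq> {}"
    by blast
qed (use assms in blast)

lemma dist_le_variation:
  assumes "bounded_variation g a b" "a \<le> b"
  shows "dist (g a) (g b) \<le> variation g a b"
proof -
  let ?s = "\<lambda>i::nat. if i = 0 then a else b"
  have "mono_on {..1} ?s" "?s ` {..1} \<subseteq> {a..b}"
    using assms(2) by (auto simp: monotone_on_def)
  from sum_dist_le_variation[OF assms(1) this] show ?thesis by simp
qed

lemma bounded_variation_subset: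
  assumes "bounded_variation g a b" "a \<le> a'" "b' \<le> b"
  shows "bounded_variation g a' b'"
proof -
  have "{a'..b'} \<subseteq> {a..b}"
    using assms by auto
  then show ?thesis
    using assms(1) unfolding bounded_variation_def by (meson order_trans)
qed

text \<open>
A monotone sequence in the large interval is split at \<open>b\<close> by truncating it from above and from
below at \<open>b\<close>; only a step across \<open>b\<close> gets longer, by the triangle inequality. Conversely,
sequences in the two parts are concatenated, and the step between them only adds length.
\<close>

lemma variation_add:
  assumes bv: "bounded_variation g a c" and "a \<le> b" "b \<le> c"
  shows "variation g a c = variation g a b + variation g b c"
proof (rule antisym)
  have bv1: "bounded_variation g a b" and bv2: "bounded_variation g b c"
    using bounded_variation_subset[OF bv] assms by auto
  show "variation g a c \<le> variation g a b + variation g b c"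
  proof (rule variation_le)
    fix n :: nat and s :: "nat \<Rightarrow> real"
    assume s: "mono_on {..n} s" "s ` {..n} \<subseteq> {a..c}"
    let ?l = "\<lambda>i. min (s i) b" and ?r = "\<lambda>i. max (s i) b"
    have "dist (g (s i)) (g (s (Suc i))) \<le>
        dist (g (?l i)) (g (?l (Suc i))) + dist (g (?r i)) (g (?r (Suc i)))" if "i < n" for i
    proof -
      have "s i \<le> s (Suc i)"
        using s(1) that by (auto simp: monotone_on_def)
      then show ?thesis
        using dist_triangle[of "g (s i)" "g (s (Suc i))" "g b"] by (auto simp: min_def max_def)
    qed
    then have "(\<Sum>i<n. dist (g (s i)) (g (s (Suc i)))) \<le>
        (\<Sum>i<n. dist (g (?l i)) (g (?l (Suc i)))) + (\<Sum>i<n. dist (g (?r i)) (g (?r (Suc i))))"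
      by (subst sum.distrib[symmetric]) (intro sum_mono, simp)
    also have "\<dots> \<le> variation g a b + variation g b c"
      using s assms by (intro add_mono sum_dist_le_variation bv1 bv2)
        (force simp: monotone_on_def min_def max_def)+
    finally show "(\<Sum>i<n. dist (g (s i)) (g (s (Suc i)))) \<le> variation g a b + variation g b c" .
  qed (use assms in auto)
  have concat: "(\<Sum>i<n. dist (g (s i)) (g (s (Suc i)))) + (\<Sum>i<m. dist (g (r i)) (g (r (Suc i))))
      \<le> variation g a c"
    if s: "mono_on {..n} s" "s ` {..n} \<subseteq> {a..b}" and r: "mono_on {..m} r" "r ` {..m} \<subseteq> {b..c}"
    for n m :: nat and s r
  proof -
    define q where "q i = (if i \<le> n then s i else r (i - Suc n))" for i
    have sb: "a \<le> s i \<and> s i \<le> b" if "i \<le> n" for i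
      using s that by auto
    have rb: "b \<le> r i \<and> r i \<le> c" if "i \<le> m" for i
      using r that by auto
    have "mono_on {..Suc n + m} q"
    proof (rule mono_onI)
      fix i j assume ij: "i \<in> {..Suc n + m}" "j \<in> {..Suc n + m}" "i \<le> j"
      consider "j \<le> n" | "i \<le> n" "n < j" | "n < i" by linarith
      then show "q i \<le> q j"
      proof cases
        case 1
        then show ?thesis
          using ij s(1) by (auto simp: q_def monotone_on_def)
      next
        case 2
        then show ?thesis
          using order_trans[of "s i" b "r (j - Suc n)"] ij sb[of i] rb[of "j - Suc n"]
          by (auto simp: q_def)
      next
        case 3
        then show ?thesis
          using ij r(1) by (auto simp: q_def monotone_on_def)
      qed
    qed
    moreover have "q ` {..Suc n + m} \<subseteq> {a..c}"
    proof -
      have "a \<le> q i \<and> q i \<le> c" if "i \<le> Suc n + m" for i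
      proof (cases "i \<le> n")
        case True
        then show ?thesis
          using sb[of i] \<open>b \<le> c\<close> by (simp add: q_def)
      next
        case False
        then have "i - Suc n \<le> m" using that by simp
        then show ?thesis
          using False rb[of "i - Suc n"] \<open>a \<le> b\<close> by (simp add: q_def)
      qed
      then show ?thesis by auto
    qed
    ultimately have "(\<Sum>i<Suc n + m. dist (g (q i)) (g (q (Suc i)))) \<le> variation g a c"
      by (rule sum_dist_le_variation[OF bv])
    moreover have "(\<Sum>i<Suc n + m. dist (g (q i)) (g (q (Suc i)))) =
        (\<Sum>i<n. dist (g (s i)) (g (s (Suc i)))) + dist (g (s n)) (g (r 0))
        + (\<Sum>i<m. dist (g (r i)) (g (r (Suc i))))"
    proof (induction m)
      case 0
      have "(\<Sum>i<n. dist (g (q i)) (g (q (Suc i)))) = (\<Sum>i<n. dist (g (s i)) (g (s (Suc i))))"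
        by (intro sum.cong) (auto simp: q_def)
      then show ?case
        by (simp add: q_def)
    next
      case (Suc m)
      then show ?case
        by (simp add: q_def Suc_diff_le)
    qed
    ultimately show ?thesis
      using zero_le_dist[of "g (s n)" "g (r 0)"] by linarith
  qed
  have "variation g a b \<le> variation g a c - variation g b c"
  proof (rule variation_le[OF \<open>a \<le> b\<close>])
    fix n :: nat and s :: "nat \<Rightarrow> real"
    assume s: "mono_on {..n} s" "s ` {..n} \<subseteq> {a..b}"
    have "variation g b c \<le> variation g a c - (\<Sum>i<n. dist (g (s i)) (g (s (Suc i))))"
      using concat[OF s] by (intro variation_le[OF \<open>b \<le> c\<close>]) (simp add: algebra_simps)
    then show "(\<Sum>i<n. dist (g (s i)) (g (s (Suc i)))) \<le> variation g a c - variation g b c"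
      by simp
  qed
  then show "variation g a b + variation g b c \<le> variation g a c"
    by simp
qed

lemma variation_reparametrize:
  fixes \<sigma> :: "real \<Rightarrow> real"
  assumes "strict_mono_on {c..d} \<sigma>" "\<sigma> ` {c..d} = {a..b}"
    and "\<And>x. x \<in> {c..d} \<Longrightarrow> h x = g (\<sigma> x)"
  shows "variation h c d = variation g a b"
proof -
  have "{\<Sum>i<n. dist (h (s i)) (h (s (Suc i))) | (n::nat) s. mono_on {..n} s \<and> s ` {..n} \<subseteq> {c..d}} =
     {\<Sum>i<n. dist (g (s i)) (g (s (Suc i))) | (n::nat) s. mono_on {..n} s \<and> s ` {..n} \<subseteq> {a..b}}"
    (is "?L = ?R")
  proof (intro equalityI subsetI)
    fix l assume "l \<in> ?L"
    then obtain n :: nat and s where s: "mono_on {..n} s" "s ` {..n} \<subseteq> {c..d}"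
      "l = (\<Sum>i<n. dist (h (s i)) (h (s (Suc i))))" by blast
    have "mono_on {..n} (\<sigma> \<circ> s)"
      using s strict_mono_on_leD[OF assms(1)]
      by (auto simp: monotone_on_def image_subset_iff simp del: atLeastAtMost_iff)
    moreover have "(\<sigma> \<circ> s) ` {..n} \<subseteq> {a..b}"
      using s(2) assms(2) by (auto simp del: atLeastAtMost_iff)
    moreover have "l = (\<Sum>i<n. dist (g ((\<sigma> \<circ> s) i)) (g ((\<sigma> \<circ> s) (Suc i))))"
      unfolding s(3) using s(2) by (intro sum.cong) (auto simp: assms(3) image_subset_iff)
    ultimately show "l \<in> ?R" by blast
  next
    fix l assume "l \<in> ?R"
    then obtain n :: nat and s where s: "mono_on {..n} s" "s ` {..n} \<subseteq> {a..b}"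
      "l = (\<Sum>i<n. dist (g (s i)) (g (s (Suc i))))" by blast
    define r where "r = inv_into {c..d} \<sigma> \<circ> s"
    have r: "r i \<in> {c..d}" "\<sigma> (r i) = s i" if "i \<le> n" for i
      using s(2) that assms(2) inv_into_into[of "s i" \<sigma> "{c..d}"] f_inv_into_f[of "s i" \<sigma> "{c..d}"]
      by (auto simp: r_def)
    have "mono_on {..n} r"
    proof (rule mono_onI)
      fix i j assume ij: "i \<in> {..n}" "j \<in> {..n}" "i \<le> j"
      then have "\<sigma> (r i) \<le> \<sigma> (r j)"
        using s(1) by (simp add: r monotone_on_def)
      then show "r i \<le> r j"
        using strict_mono_onD[OF assms(1), of "r j" "r i"] r[of i] r[of j] ij by force
    qed
    moreover have "r ` {..n} \<subseteq> {c..d}"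
      using r by blast
    moreover have "l = (\<Sum>i<n. dist (h (r i)) (h (r (Suc i))))"
      unfolding s(3) using r by (intro sum.cong) (auto simp: assms(3))
    ultimately show "l \<in> ?L" by blast
  qed
  then show ?thesis
    by (simp add: variation_def)
qed

text \<open>
The arc-length function traverses boundary arcs clockwise for negative angles; together with the
next lemma, this reduces everything to counterclockwise arcs.
\<close>

lemma path_length_reversepath: "path_length (reversepath g) = path_length g"
proof -
  have *: "{\<Sum>i<n. dist (g (s i)) (g (s (Suc i))) | (n::nat) s. mono_on {..n} s \<and> s ` {..n} \<subseteq> {0..1}}
     \<subseteq> {\<Sum>i<n. dist (reversepath g (s i)) (reversepath g (s (Suc i))) | (n::nat) s.
         mono_on {..n} s \<and> s ` {..n} \<subseteq> {0..1}}" for g :: "real \<Rightarrow> real^2"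
  proof
    fix l assume "l \<in> {\<Sum>i<n. dist (g (s i)) (g (s (Suc i))) | (n::nat) s.
        mono_on {..n} s \<and> s ` {..n} \<subseteq> {0..1}}"
    then obtain n :: nat and s where s: "mono_on {..n} s" "s ` {..n} \<subseteq> {0..1}"
      "l = (\<Sum>i<n. dist (g (s i)) (g (s (Suc i))))" by blast
    define r where "r i = 1 - s (n - i)" for i
    have "mono_on {..n} r" "r ` {..n} \<subseteq> {0..1}"
      using s by (auto simp: r_def monotone_on_def image_subset_iff)
    moreover have "l = (\<Sum>i<n. dist (reversepath g (r i)) (reversepath g (r (Suc i))))"
    proof -
      have "l = (\<Sum>i<n. dist (g (s (n - Suc i))) (g (s (Suc (n - Suc i)))))"
        unfolding s(3) by (rule sum.nat_diff_reindex[symmetric])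
      also have "\<dots> = (\<Sum>i<n. dist (reversepath g (r i)) (reversepath g (r (Suc i))))"
        by (intro sum.cong) (auto simp: r_def reversepath_def dist_commute Suc_diff_Suc)
      finally show ?thesis .
    qed
    ultimately show "l \<in> {\<Sum>i<n. dist (reversepath g (s i)) (reversepath g (s (Suc i))) | (n::nat) s.
         mono_on {..n} s \<and> s ` {..n} \<subseteq> {0..1}}" by blast
  qed
  show ?thesis
    unfolding path_length_def using *[of g] *[of "reversepath g"]
    by (intro arg_cong[where f = Sup] equalityI) simp_all
qed

lemma boundary_arc_length_commute: "boundary_arc_length A p q = boundary_arc_length A q p"
proof -
  have *: "\<exists>g. arc g \<and> path_image g \<subseteq> frontier A \<and> pathstart g = q \<and> pathfinish g = p \<and> l = path_length g"
    if "\<exists>g. arc g \<and> path_image g \<subseteq> frontier A \<and> pathstart g = p \<and> pathfinish g = q \<and> l = path_length g"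
    for p q l
  proof -
    from that obtain g where "arc g" "path_image g \<subseteq> frontier A" "pathstart g = p"
      "pathfinish g = q" "l = path_length g" by blast
    then show ?thesis
      by (intro exI[of _ "reversepath g"]) (simp add: arc_reversepath path_length_reversepath)
  qed
  have "(\<exists>g. arc g \<and> path_image g \<subseteq> frontier A \<and> pathstart g = p \<and> pathfinish g = q \<and> l = path_length g)
    \<longleftrightarrow> (\<exists>g. arc g \<and> path_image g \<subseteq> frontier A \<and> pathstart g = q \<and> pathfinish g = p \<and> l = path_length g)"
    for l using *[of p q l] *[of q p l] by iprover
  then show ?thesis
    by (simp add: boundary_arc_length_def eq_commute[of p q])
qed

section \<open>Sets whose recession cone is the given angle\<close>

text \<open>
The direction is a limit of normalized points of \<open>S\<close> that tend to infinity. A point \<open>a\<close> can be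
moved by that limit because the segments from \<open>a\<close> to those far points lie in the closed set. The
last conclusion says that a lower bound for a linear functional on \<open>S\<close> survives in the limit as
nonnegativity on the direction.
\<close>

lemma unbounded_convex_recession_direction:
  fixes A :: "'a::euclidean_space set"
  assumes "closed A" "convex A" "S \<subseteq> A" "\<not> bounded S"
  obtains d where "norm d = 1" "\<And>a. a \<in> A \<Longrightarrow> d + a \<in> A"
    "\<And>u k. (\<And>x. x \<in> S \<Longrightarrow> k \<le> u \<bullet> x) \<Longrightarrow> 0 \<le> u \<bullet> d"
proof -
  have "\<exists>x\<in>S. real n + 1 < norm x" for n
    using \<open>\<not> bounded S\<close> unfolding bounded_iff by (metis not_le)
  then obtain x where x: "\<And>n. x n \<in> S" "\<And>n. real n + 1 < norm (x n)"
    by metis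
  define v where "v n = x n /\<^sub>R norm (x n)" for n
  have "v n \<in> sphere 0 1" for n
  proof -
    have "norm (x n) \<noteq> 0" using x(2)[of n] by linarith
    then show ?thesis by (simp add: v_def)
  qed
  then obtain d r where d: "d \<in> sphere 0 1" "strict_mono r" "(v \<circ> r) \<longlonglongrightarrow> d"
    using compact_sphere unfolding compact_def by metis
  define e where "e n = inverse (norm (x (r n)))" for n
  have e01: "0 < e n" "e n \<le> 1" and en: "e n \<le> inverse (real (Suc n))" for n
  proof -
    have "real n + 1 < norm (x (r n))"
      using x(2)[of "r n"] seq_suble[OF d(2), of n] by linarith
    then show "e n \<le> inverse (real (Suc n))"
      unfolding e_def by (intro le_imp_inverse_le) auto
    from \<open>real n + 1 < norm (x (r n))\<close> show "0 < e n" "e n \<le> 1"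
      by (auto simp: e_def intro!: inverse_le_1_iff[THEN iffD2])
  qed
  have e0: "e \<longlonglongrightarrow> 0"
  proof (rule tendsto_sandwich)
    show "\<forall>\<^sub>F n in sequentially. 0 \<le> e n" "\<forall>\<^sub>F n in sequentially. e n \<le> inverse (real (Suc n))"
      using e01(1) en by (simp_all add: less_imp_le del: of_nat_Suc)
  qed (rule tendsto_const, rule LIMSEQ_inverse_real_of_nat)
  have vr: "v (r n) = e n *\<^sub>R x (r n)" for n
    by (simp add: v_def e_def)
  have "d + a \<in> A" if "a \<in> A" for a
  proof (rule closed_sequentially[OF \<open>closed A\<close>])
    show "(1 - e n) *\<^sub>R a + e n *\<^sub>R x (r n) \<in> A" for n
      using e01[of n] x(1) assms(3) that by (intro convexD[OF \<open>convex A\<close>]) (auto intro: less_imp_le)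
    have "(\<lambda>n. (1 - e n) *\<^sub>R a + v (r n)) \<longlonglongrightarrow> (1 - 0) *\<^sub>R a + d"
      using d(3) e0 by (intro tendsto_intros) (simp_all add: o_def)
    then show "(\<lambda>n. (1 - e n) *\<^sub>R a + e n *\<^sub>R x (r n)) \<longlonglongrightarrow> d + a"
      by (simp add: vr add.commute)
  qed
  moreover have "0 \<le> u \<bullet> d" if "\<And>x. x \<in> S \<Longrightarrow> k \<le> u \<bullet> x" for u k
  proof (rule LIMSEQ_le)
    show "(\<lambda>n. e n * k) \<longlonglongrightarrow> 0"
      using tendsto_mult[OF e0 tendsto_const[of k]] by simp
    show "(\<lambda>n. u \<bullet> v (r n)) \<longlonglongrightarrow> u \<bullet> d"
      using d(3) by (intro tendsto_intros) (simp add: o_def)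
    show "\<exists>N. \<forall>n\<ge>N. e n * k \<le> u \<bullet> v (r n)"
      using that[OF x(1)] e01(1) by (auto simp: vr intro: less_imp_le)
  qed
  ultimately show ?thesis
    using d(1) by (intro that) auto
qed

text \<open>
A support set lies on a line parallel to the tangent, so the tangential coordinate identifies it
with a compact interval; the end points are also characterized by that coordinate.
\<close>

lemma support_set_segment:
  assumes S: "S = support_set A (direction t)" and "convex A" "compact S" "S \<noteq> {}"
  obtains p q where "p \<in> S" "q \<in> S" "S = closed_segment p q" "segment_center S = midpoint p q"
    "\<And>x. x \<in> S \<Longrightarrow> tangent t \<bullet> p \<le> tangent t \<bullet> x"
    "\<And>x. x \<in> S \<Longrightarrow> tangent t \<bullet> x \<le> tangent t \<bullet> q"
proof -
  have cont: "continuous_on S (\<lambda>x. tangent t \<bullet> x)"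
    by (intro continuous_intros)
  obtain p where p: "p \<in> S" "\<And>x. x \<in> S \<Longrightarrow> tangent t \<bullet> p \<le> tangent t \<bullet> x"
    using continuous_attains_inf[OF \<open>compact S\<close> \<open>S \<noteq> {}\<close> cont] by blast
  obtain q where q: "q \<in> S" "\<And>x. x \<in> S \<Longrightarrow> tangent t \<bullet> x \<le> tangent t \<bullet> q"
    using continuous_attains_sup[OF \<open>compact S\<close> \<open>S \<noteq> {}\<close> cont] by blast
  have eq: "direction t \<bullet> x = direction t \<bullet> p" if "x \<in> S" for x
    using that p(1) by (auto simp: S support_set_def intro: antisym)
  have "convex S"
  proof -
    have "S = A \<inter> {x. direction t \<bullet> x = direction t \<bullet> p}"
    proof (intro equalityI subsetI)
      fix x assume "x \<in> A \<inter> {x. direction t \<bullet> x = direction t \<bullet> p}"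
      then show "x \<in> S"
        using p(1) unfolding S support_set_def by simp
    next
      fix x assume "x \<in> S"
      moreover from this have "x \<in> A"
        unfolding S support_set_def by simp
      ultimately show "x \<in> A \<inter> {x. direction t \<bullet> x = direction t \<bullet> p}"
        using eq by blast
    qed
    then show ?thesis
      using \<open>convex A\<close> by (simp add: convex_Int convex_hyperplane)
  qed
  have "S = closed_segment p q"
  proof
    show "closed_segment p q \<subseteq> S"
      using \<open>convex S\<close> p(1) q(1) by (intro closed_segment_subset)
    show "S \<subseteq> closed_segment p q"
    proof
      fix x assume "x \<in> S"
      define l m where "l = tangent t \<bullet> (x - p)" and "m = tangent t \<bullet> (q - p)"
      have "0 \<le> l" "l \<le> m"
        using p(2) q(2) \<open>x \<in> S\<close> by (auto simp: l_def m_def inner_diff_right)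
      have x: "x = p + l *\<^sub>R tangent t"
        using direction_tangent_decomposition[of "x - p" t] eq[OF \<open>x \<in> S\<close>]
        by (simp add: l_def inner_diff_right algebra_simps)
      have q: "q = p + m *\<^sub>R tangent t"
        using direction_tangent_decomposition[of "q - p" t] eq[OF q(1)]
        by (simp add: m_def inner_diff_right algebra_simps)
      have "x = (1 - l / m) *\<^sub>R p + (l / m) *\<^sub>R q"
        using \<open>0 \<le> l\<close> \<open>l \<le> m\<close> by (cases "m = 0") (simp_all add: x q algebra_simps)
      then show "x \<in> closed_segment p q"
        using \<open>0 \<le> l\<close> \<open>l \<le> m\<close> unfolding closed_segment_def
        by (intro CollectI exI[of _ "l / m"]) (auto simp: divide_le_eq_1)
    qed
  qed
  moreover have "segment_center (closed_segment p q) = midpoint p q"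
    unfolding segment_center_def
    by (rule the_equality) (auto simp: doubleton_eq_iff midpoint_sym)
  ultimately show ?thesis
    using p q by (intro that) auto
qed

lemma supporting_hyperplane_frontier:
  fixes S :: "'a::euclidean_space set"
  assumes "convex S" "closed S" "x \<in> frontier S"
  obtains u where "u \<noteq> 0" "\<And>b. b \<in> S \<Longrightarrow> u \<bullet> b \<le> u \<bullet> x"
proof (cases "interior S = {}")
  case True
  obtain a b where ab: "a \<noteq> 0" "S \<subseteq> {x. a \<bullet> x = b}"
    by (rule empty_interior_subset_hyperplane[OF \<open>convex S\<close> True])
  moreover have "x \<in> S"
    using assms(2,3) by (simp add: frontier_def)
  ultimately have "a \<bullet> y = a \<bullet> x" if "y \<in> S" for y
    using that by blast
  then show ?thesis
    using ab(1) by (intro that[of a]) simp_all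
next
  case False
  then have "x \<in> S" "x \<notin> rel_interior S"
    using assms(2,3) by (auto simp: frontier_def rel_interior_nonempty_interior)
  then obtain a where "a \<noteq> 0" "\<And>y. y \<in> S \<Longrightarrow> a \<bullet> x \<le> a \<bullet> y"
    using supporting_hyperplane_rel_boundary[OF \<open>convex S\<close>] by blast
  then show ?thesis
    by (intro that[of "- a"]) auto
qed

text \<open>
An arbitrary separating functional \<open>u\<close> is nonpositive on the recession angle but may vanish on
one of its sides, and then its angle is only \<open>\<theta>\<close> or \<open>- \<theta>\<close>.
Adding a small multiple of \<open>direction 0\<close>, which is bounded above on \<open>S\<close>, keeps the separation and
makes the functional negative on all nonzero recession directions, that is, moves its angle into
the open interval.
\<close>

lemma separating_direction:
  assumes \<theta>: "0 < \<theta>" "\<theta> \<le> pi / 2" and S: "S \<noteq> {}" "closed S" "convex S"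
    and add_mem: "\<And>a r \<phi>. a \<in> S \<Longrightarrow> 0 \<le> r \<Longrightarrow> \<bar>\<phi> - pi\<bar> \<le> pi / 2 - \<theta> \<Longrightarrow> r *\<^sub>R direction \<phi> + a \<in> S"
    and le_c: "\<And>a. a \<in> S \<Longrightarrow> direction 0 \<bullet> a \<le> c"
    and "z \<notin> S"
  obtains t where "\<bar>t\<bar> < \<theta>" "\<And>a. a \<in> S \<Longrightarrow> direction t \<bullet> a < direction t \<bullet> z"
proof -
  obtain w b where w: "w \<bullet> z < b" "\<And>x. x \<in> S \<Longrightarrow> b < w \<bullet> x"
    using separating_hyperplane_closed_point[OF S(3,2) \<open>z \<notin> S\<close>] by blast
  define u where "u = - w"
  have u: "- b < u \<bullet> z" "\<And>x. x \<in> S \<Longrightarrow> u \<bullet> x < - b"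
    using w by (auto simp: u_def)
  obtain a0 where "a0 \<in> S" using S(1) by blast
  have polar: "u \<bullet> direction \<phi> \<le> 0" if "\<bar>\<phi> - pi\<bar> \<le> pi / 2 - \<theta>" for \<phi>
  proof (rule ccontr)
    assume "\<not> u \<bullet> direction \<phi> \<le> 0"
    define r where "r = \<bar>- b - u \<bullet> a0\<bar> / (u \<bullet> direction \<phi>)"
    have "r *\<^sub>R direction \<phi> + a0 \<in> S"
      using that \<open>a0 \<in> S\<close> \<open>\<not> u \<bullet> direction \<phi> \<le> 0\<close> by (intro add_mem) (auto simp: r_def)
    from u(2)[OF this] show False
      using \<open>\<not> u \<bullet> direction \<phi> \<le> 0\<close> by (simp add: inner_add_right r_def)
  qed
  \<comment> \<open>the perturbation costs at most one half of the gap \<open>u \<bullet> z + b\<close>\<close>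
  define D where "D = 1 + \<bar>c - direction 0 \<bullet> z\<bar>"
  define \<epsilon> where "\<epsilon> = (u \<bullet> z + b) / (2 * D)"
  have D: "0 < D" "c - direction 0 \<bullet> z \<le> D"
    unfolding D_def by linarith+
  then have "0 < \<epsilon>" and half: "\<epsilon> * D = (u \<bullet> z + b) / 2"
    using u(1) by (simp_all add: \<epsilon>_def)
  have gap: "\<epsilon> * (c - direction 0 \<bullet> z) < u \<bullet> z + b"
  proof -
    have "\<epsilon> * (c - direction 0 \<bullet> z) \<le> \<epsilon> * D"
      using D(2) \<open>0 < \<epsilon>\<close> by (intro mult_left_mono) simp_all
    also have "\<dots> < u \<bullet> z + b"
      using half u(1) by simp
    finally show ?thesis .
  qed
  define u' where "u' = u + \<epsilon> *\<^sub>R direction 0"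
  have sep: "u' \<bullet> x < u' \<bullet> z" if "x \<in> S" for x
  proof -
    have "\<epsilon> * (direction 0 \<bullet> x) \<le> \<epsilon> * c"
      using le_c[OF that] \<open>0 < \<epsilon>\<close> by (intro mult_left_mono) simp_all
    then show ?thesis
      using u(2)[OF that] gap by (simp add: u'_def inner_add_left algebra_simps)
  qed
  \<comment> \<open>the perturbed functional is negative on nonzero recession directions, so its angle is in range\<close>
  have neg: "u' \<bullet> direction \<phi> < 0" if "\<bar>\<phi> - pi\<bar> \<le> pi / 2 - \<theta>" for \<phi>
  proof -
    have "0 < cos (\<phi> - pi)"
      using that \<theta> by (intro cos_gt_zero_pi) linarith+
    then have "0 < - \<epsilon> * cos \<phi>"
      using \<open>0 < \<epsilon>\<close> by (simp add: mult_pos_neg cos_diff)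
    then show ?thesis
      using polar[OF that] by (simp add: u'_def inner_add_left inner_direction)
  qed
  define t where "t = arctan (u' $ 2 / u' $ 1)"
  define \<rho> where "\<rho> = u' $ 1 / cos t"
  have "0 < u' $ 1"
    using neg[of pi] \<theta> by (simp add: inner_real2)
  have ct: "0 < cos t" and t: "\<bar>t\<bar> < pi / 2"
    using arctan_bounded[of "u' $ 2 / u' $ 1"] by (auto simp: t_def cos_gt_zero_pi)
  then have "0 < \<rho>"
    using \<open>0 < u' $ 1\<close> by (simp add: \<rho>_def)
  have u': "u' = \<rho> *\<^sub>R direction t"
  proof -
    have "sin t / cos t = u' $ 2 / u' $ 1"
      using tan_arctan[of "u' $ 2 / u' $ 1"] by (simp add: t_def tan_def)
    then have "u' $ 2 = \<rho> * sin t"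
      using \<open>0 < u' $ 1\<close> ct by (simp add: \<rho>_def field_simps)
    then show ?thesis
      using ct by (simp add: vec_eq_iff forall_2 \<rho>_def)
  qed
  have cneg: "cos (t - \<phi>) < 0" if "\<bar>\<phi> - pi\<bar> \<le> pi / 2 - \<theta>" for \<phi>
    using neg[OF that] \<open>0 < \<rho>\<close> by (simp add: u' inner_direction mult_less_0_iff)
  have "\<bar>t\<bar> < \<theta>"
  proof (rule ccontr)
    assume "\<not> \<bar>t\<bar> < \<theta>"
    then consider "\<theta> \<le> t" | "t \<le> - \<theta>" by linarith
    then show False
    proof cases
      case 1
      then have "0 \<le> cos (t - (pi / 2 + \<theta>))"
        using t \<theta> by (intro cos_ge_zero) linarith+
      then show False
        using cneg[of "pi / 2 + \<theta>"] \<theta> by simp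
    next
      case 2
      then have "0 \<le> cos (t - (3 * pi / 2 - \<theta>) + 2 * pi)"
        using t \<theta> by (intro cos_ge_zero) linarith+
      then have "0 \<le> cos (t - (3 * pi / 2 - \<theta>))"
        by (simp only: cos_periodic)
      then show False
        using cneg[of "3 * pi / 2 - \<theta>"] \<theta> by simp
    qed
  qed
  moreover have "direction t \<bullet> a < direction t \<bullet> z" if "a \<in> S" for a
    using sep[OF that] \<open>0 < \<rho>\<close> by (simp add: u')
  ultimately show ?thesis by (rule that)
qed

locale angle_recession =
  fixes \<theta> :: real and A :: "(real^2) set"
  assumes \<theta>: "0 < \<theta>" "\<theta> \<le> pi / 2"
    and A_rec: "A \<in> convex_sets_rec (left_angle \<theta>)"
begin

lemma nonempty: "A \<noteq> {}" and closed: "closed A" and convex: "convex A"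
  and recession: "recession_cone A = left_angle \<theta>"
  using A_rec by (auto simp: convex_sets_rec_def)

lemma add_mem:
  assumes "a \<in> A" "0 \<le> r" "\<bar>\<phi> - pi\<bar> \<le> pi / 2 - \<theta>"
  shows "r *\<^sub>R direction \<phi> + a \<in> A"
proof -
  have "r *\<^sub>R direction \<phi> \<in> recession_cone A"
    using assms unfolding recession left_angle_def by blast
  then show ?thesis
    using assms(1) by (auto simp: recession_cone_def)
qed

text \<open>
A recession direction of the superlevel set would lie in the recession angle, on which the
functional is strictly negative away from the origin because \<open>t\<close> lies in the open interval.
\<close>

lemma bounded_superlevel:
  assumes "\<bar>t\<bar> < \<theta>"
  shows "bounded {a \<in> A. k \<le> direction t \<bullet> a}"
proof (rule ccontr)
  assume "\<not> bounded {a \<in> A. k \<le> direction t \<bullet> a}"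
  then obtain d where d: "norm d = 1" "\<And>a. a \<in> A \<Longrightarrow> d + a \<in> A"
    "\<And>u k'. (\<And>x. x \<in> {a \<in> A. k \<le> direction t \<bullet> a} \<Longrightarrow> k' \<le> u \<bullet> x) \<Longrightarrow> 0 \<le> u \<bullet> d"
    using unbounded_convex_recession_direction[OF closed convex, of "{a \<in> A. k \<le> direction t \<bullet> a}"]
    by blast
  have "d \<in> left_angle \<theta>"
    using d(2) unfolding recession[symmetric] recession_cone_def by auto
  then obtain r \<phi> where r: "d = r *\<^sub>R direction \<phi>" "0 \<le> r" "\<bar>\<phi> - pi\<bar> \<le> pi / 2 - \<theta>"
    unfolding left_angle_def by blast
  have "r = 1"
    using d(1) r by simp
  moreover have "0 < cos (t - \<phi> + pi)"
    using assms r(3) by (intro cos_gt_zero_pi) linarith+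
  ultimately have "direction t \<bullet> d < 0"
    by (simp add: r inner_direction)
  moreover have "0 \<le> direction t \<bullet> d"
    by (rule d(3)[of k]) simp
  ultimately show False by simp
qed

lemma support_set_compact:
  assumes "\<bar>t\<bar> < \<theta>"
  shows "support_set A (direction t) \<noteq> {}" "compact (support_set A (direction t))"
proof -
  obtain a0 where "a0 \<in> A" using nonempty by blast
  have cpt: "compact {a \<in> A. k \<le> direction t \<bullet> a}" for k
  proof -
    have "{a \<in> A. k \<le> direction t \<bullet> a} = A \<inter> {a. k \<le> direction t \<bullet> a}" by auto
    then show ?thesis
      using bounded_superlevel[OF assms, of k] closed
      by (simp add: compact_eq_bounded_closed closed_Int closed_halfspace_ge)
  qed
  have "continuous_on {a \<in> A. direction t \<bullet> a0 \<le> direction t \<bullet> a} (\<lambda>x. direction t \<bullet> x)"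
    by (intro continuous_intros)
  then obtain m where m: "m \<in> A" "direction t \<bullet> a0 \<le> direction t \<bullet> m"
    "\<And>x. x \<in> A \<Longrightarrow> direction t \<bullet> a0 \<le> direction t \<bullet> x \<Longrightarrow> direction t \<bullet> x \<le> direction t \<bullet> m"
    using continuous_attains_sup[OF cpt, of "direction t \<bullet> a0"] \<open>a0 \<in> A\<close> by blast
  then have max: "direction t \<bullet> x \<le> direction t \<bullet> m" if "x \<in> A" for x
    using that by (cases "direction t \<bullet> a0 \<le> direction t \<bullet> x") auto
  then have "m \<in> support_set A (direction t)"
    using m(1) by (simp add: support_set_def)
  then show "support_set A (direction t) \<noteq> {}" by blast
  have "support_set A (direction t) = {a \<in> A. direction t \<bullet> m \<le> direction t \<bullet> a}"
    using max m(1) by (auto simp: support_set_def intro: order_trans)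
  then show "compact (support_set A (direction t))"
    using cpt by simp
qed

lemma support_segment:
  assumes "\<bar>t\<bar> < \<theta>"
  obtains p q where "p \<in> support_set A (direction t)" "q \<in> support_set A (direction t)"
    "support_set A (direction t) = closed_segment p q" "support_center A t = midpoint p q"
    "\<And>x. x \<in> support_set A (direction t) \<Longrightarrow> tangent t \<bullet> p \<le> tangent t \<bullet> x"
    "\<And>x. x \<in> support_set A (direction t) \<Longrightarrow> tangent t \<bullet> x \<le> tangent t \<bullet> q"
  using support_set_segment[OF refl convex support_set_compact(2,1)[OF assms]]
  unfolding support_center_def by metis

lemma support_center_mem:
  assumes "\<bar>t\<bar> < \<theta>"
  shows "support_center A t \<in> support_set A (direction t)"
  by (rule support_segment[OF assms]) (simp add: midpoint_in_closed_segment)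

lemma support_center_in: "\<bar>t\<bar> < \<theta> \<Longrightarrow> support_center A t \<in> A"
  and inner_le_support_center:
    "\<bar>t\<bar> < \<theta> \<Longrightarrow> a \<in> A \<Longrightarrow> direction t \<bullet> a \<le> direction t \<bullet> support_center A t"
  using support_center_mem[of t] by (auto simp: support_set_def)

end

section \<open>The boundary as a graph over the vertical axis\<close>

text \<open>
Since the negative horizontal axis consists of recession directions, \<open>A\<close> is the region to the
left of a graph over the vertical axis, and this is the point of the graph at height \<open>y\<close>. It
parametrizes the part of the boundary that contains the support centers.
\<close>

definition rightmost :: "(real^2) set \<Rightarrow> real \<Rightarrow> real^2" where
  "rightmost A y = (SOME x. x \<in> A \<and> x $ 2 = y \<and> (\<forall>b\<in>A. b $ 2 = y \<longrightarrow> b $ 1 \<le> x $ 1))"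

context angle_recession
begin

lemma cos_pos: "\<bar>t\<bar> < \<theta> \<Longrightarrow> 0 < cos t"
  using \<theta> by (intro cos_gt_zero_pi) linarith+

lemma rightmost:
  assumes "a \<in> A"
  shows "rightmost A (a $ 2) \<in> A" "rightmost A (a $ 2) $ 2 = a $ 2"
    and "a $ 1 \<le> rightmost A (a $ 2) $ 1"
proof -
  define K where "K = {b \<in> A. a $ 1 \<le> direction 0 \<bullet> b} \<inter> {b. direction (pi / 2) \<bullet> b = a $ 2}"
  have [simp]: "direction 0 \<bullet> b = b $ 1" "direction (pi / 2) \<bullet> b = b $ 2" for b
    by (simp_all add: inner_real2)
  have "K = A \<inter> {b. direction 0 \<bullet> b \<ge> a $ 1} \<inter> {b. direction (pi / 2) \<bullet> b = a $ 2}"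
    unfolding K_def by blast
  then have "closed K"
    using closed by (simp only: closed_Int closed_halfspace_ge closed_hyperplane)
  moreover have "bounded K"
    using bounded_superlevel[of 0 "a $ 1"] \<theta> unfolding K_def by (intro bounded_Int) simp
  ultimately have "compact K" by (simp add: compact_eq_bounded_closed)
  moreover have "a \<in> K" using assms by (simp add: K_def)
  moreover have "continuous_on K (\<lambda>x. x $ 1)" by (intro continuous_intros)
  ultimately obtain m where m: "m \<in> K" "\<And>b. b \<in> K \<Longrightarrow> b $ 1 \<le> m $ 1"
    using continuous_attains_sup[of K "\<lambda>x. x $ 1"] by blast
  have "b $ 1 \<le> m $ 1" if "b \<in> A" "b $ 2 = a $ 2" for b
    using m(2)[of b] m(1) that by (cases "a $ 1 \<le> b $ 1") (auto simp: K_def)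
  then have "m \<in> A \<and> m $ 2 = a $ 2 \<and> (\<forall>b\<in>A. b $ 2 = a $ 2 \<longrightarrow> b $ 1 \<le> m $ 1)"
    using m(1) by (auto simp: K_def)
  from someI[of "\<lambda>x. x \<in> A \<and> x $ 2 = a $ 2 \<and> (\<forall>b\<in>A. b $ 2 = a $ 2 \<longrightarrow> b $ 1 \<le> x $ 1)", OF this]
  show "rightmost A (a $ 2) \<in> A" "rightmost A (a $ 2) $ 2 = a $ 2"
    "a $ 1 \<le> rightmost A (a $ 2) $ 1"
    using assms by (auto simp: rightmost_def)
qed

lemma heights_interval:
  assumes "p \<in> A" "q \<in> A" "p $ 2 \<le> y" "y \<le> q $ 2"
  shows "\<exists>a\<in>A. a $ 2 = y"
proof -
  have "convex ((\<lambda>x. x $ 2) ` A)"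
    by (intro convex_linear_image convex bounded_linear.linear bounded_linear_vec_nth)
  then have "y \<in> (\<lambda>x. x $ 2) ` A"
    using assms by (meson image_eqI mem_is_interval_1_I is_interval_convex_1)
  then show ?thesis by blast
qed

lemma support_center_eq_rightmost:
  assumes "\<bar>t\<bar> < \<theta>"
  shows "rightmost A (support_center A t $ 2) = support_center A t"
proof -
  let ?p = "support_center A t"
  note r = rightmost[OF support_center_in[OF assms]]
  have "cos t * rightmost A (?p $ 2) $ 1 \<le> cos t * ?p $ 1"
    using inner_le_support_center[OF assms r(1)] r(2) by (simp add: inner_real2)
  then show ?thesis
    using r cos_pos[OF assms] by (simp add: vec_eq_iff forall_2)
qed

text \<open>
On the graph the functional \<open>direction t\<close> is a concave function of the height, with its maximum at
the support center; hence it decreases in both directions away from there. Using a segment in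
the hypothesis covers both sides at once.
\<close>

lemma inner_rightmost_antimono:
  assumes "\<bar>t\<bar> < \<theta>" "a \<in> A" "y \<in> closed_segment (support_center A t $ 2) (a $ 2)"
  shows "direction t \<bullet> rightmost A (a $ 2) \<le> direction t \<bullet> rightmost A y"
proof -
  let ?p = "support_center A t"
  let ?g = "rightmost A (a $ 2)"
  obtain l where l: "0 \<le> l" "l \<le> 1" "y = (1 - l) * ?p $ 2 + l * a $ 2"
    using assms(3) by (auto simp: closed_segment_def)
  define z where "z = (1 - l) *\<^sub>R ?p + l *\<^sub>R ?g"
  have "z \<in> A"
    unfolding z_def using l rightmost(1)[OF assms(2)] support_center_in[OF assms(1)]
    by (intro convexD[OF convex]) auto
  moreover have z2: "z $ 2 = y"
    using l rightmost(2)[OF assms(2)] by (simp add: z_def)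
  ultimately have z: "z $ 1 \<le> rightmost A y $ 1" "rightmost A y $ 2 = z $ 2"
    using rightmost[of z] by auto
  have "direction t \<bullet> ?g \<le> direction t \<bullet> z"
  proof -
    have "(1 - l) * (direction t \<bullet> ?g) \<le> (1 - l) * (direction t \<bullet> ?p)"
      using l inner_le_support_center[OF assms(1) rightmost(1)[OF assms(2)]]
      by (intro mult_left_mono) auto
    then show ?thesis
      by (simp add: z_def inner_add_right algebra_simps)
  qed
  also have "\<dots> \<le> direction t \<bullet> rightmost A y"
    using z cos_pos[OF assms(1)] by (simp add: inner_real2)
  finally show ?thesis .
qed

lemma inner_rightmost_diff:
  assumes "\<bar>s\<bar> < \<theta>" "\<bar>t\<bar> < \<theta>"
    and "support_center A s $ 2 \<le> y" "y \<le> y'" "y' \<le> support_center A t $ 2"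
  shows "direction s \<bullet> (rightmost A y' - rightmost A y) \<le> 0"
    and "0 \<le> direction t \<bullet> (rightmost A y' - rightmost A y)"
proof -
  note int = heights_interval[OF support_center_in[OF assms(1)] support_center_in[OF assms(2)]]
  obtain a a' where a: "a \<in> A" "a $ 2 = y" "a' \<in> A" "a' $ 2 = y'"
    using int[of y] int[of y'] assms by auto
  show "direction s \<bullet> (rightmost A y' - rightmost A y) \<le> 0"
    using inner_rightmost_antimono[OF assms(1) a(3), of y] assms a
    by (simp add: inner_diff_right closed_segment_eq_real_ivl)
  show "0 \<le> direction t \<bullet> (rightmost A y' - rightmost A y)"
    using inner_rightmost_antimono[OF assms(2) a(1), of y'] assms a
    by (simp add: inner_diff_right closed_segment_eq_real_ivl)
qed

lemma support_center_height_mono: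
  assumes "\<bar>s\<bar> < \<theta>" "\<bar>t\<bar> < \<theta>" "s \<le> t"
  shows "support_center A s $ 2 \<le> support_center A t $ 2"
proof (cases "s = t")
  case False
  let ?x = "support_center A t - support_center A s"
  have "0 * norm ?x \<le> tangent 0 \<bullet> ?x"
    using inner_le_support_center[OF assms(1) support_center_in[OF assms(2)]]
      inner_le_support_center[OF assms(2) support_center_in[OF assms(1)]] assms False \<theta>
      cos_pos[of s] cos_pos[of t]
    by (intro cone_inner_tangent[of s _ t]) (auto simp: inner_diff_right)
  then show ?thesis
    by (simp add: inner_real2)
qed simp

text \<open>
With \<open>m = 0\<close> this makes the graph Lipschitz over the height, since the tangents at angles in
the open interval are not horizontal; with \<open>m\<close> close to \<open>s\<close> and \<open>t\<close> it says that a short piece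
of the boundary is almost straight.
\<close>

lemma norm_rightmost_diff:
  assumes "\<bar>s\<bar> < \<theta>" "\<bar>t\<bar> < \<theta>" "s < t"
    and "support_center A s $ 2 \<le> y" "y \<le> y'" "y' \<le> support_center A t $ 2"
    and "0 \<le> c" "c \<le> cos (m - s)" "c \<le> cos (t - m)"
  shows "c * norm (rightmost A y' - rightmost A y) \<le> tangent m \<bullet> (rightmost A y' - rightmost A y)"
  using assms \<theta> by (intro cone_inner_tangent[of s _ t] inner_rightmost_diff) auto

lemma sum_dist_rightmost:
  assumes "\<bar>s\<bar> < \<theta>" "\<bar>t\<bar> < \<theta>" "s < t"
    and "0 \<le> c" "c \<le> cos (m - s)" "c \<le> cos (t - m)"
    and r: "mono_on {..n} r" "r ` {..n} \<subseteq> {support_center A s $ 2..support_center A t $ 2}"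
  shows "c * (\<Sum>i<n. dist (rightmost A (r i)) (rightmost A (r (Suc i))))
    \<le> tangent m \<bullet> (support_center A t - support_center A s)"
proof -
  let ?g = "rightmost A" and ?y = "\<lambda>t. support_center A t $ 2"
  note le = norm_rightmost_diff[OF assms(1-3) _ _ _ assms(4-6)]
  have nonneg: "0 \<le> tangent m \<bullet> (?g y' - ?g y)" if "?y s \<le> y" "y \<le> y'" "y' \<le> ?y t" for y y'
    using le[OF that] \<open>0 \<le> c\<close> by (meson mult_nonneg_nonneg norm_ge_zero order_trans)
  have rb: "?y s \<le> r i \<and> r i \<le> ?y t" if "i \<le> n" for i
    using r(2) that by auto
  have "c * (\<Sum>i<n. dist (?g (r i)) (?g (r (Suc i)))) = (\<Sum>i<n. c * norm (?g (r (Suc i)) - ?g (r i)))"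
    by (simp add: sum_distrib_left dist_norm norm_minus_commute)
  also have "\<dots> \<le> (\<Sum>i<n. tangent m \<bullet> (?g (r (Suc i)) - ?g (r i)))"
    using rb r(1) by (intro sum_mono le) (auto simp: monotone_on_def)
  also have "\<dots> = tangent m \<bullet> (?g (r n) - ?g (r 0))"
    by (simp only: inner_sum_right[symmetric] sum_lessThan_telescope[of "\<lambda>i. ?g (r i)"])
  also have "\<dots> \<le> tangent m \<bullet> (?g (?y t) - ?g (?y s))"
    using nonneg[of "r n" "?y t"] nonneg[of "?y s" "r 0"] rb[of 0] rb[of n]
    by (simp add: inner_diff_right)
  finally show ?thesis
    by (simp add: support_center_eq_rightmost assms)
qed

lemma bounded_variation_rightmost:
  assumes "\<bar>s\<bar> < \<theta>" "\<bar>t\<bar> < \<theta>" "s < t"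
  shows "bounded_variation (rightmost A) (support_center A s $ 2) (support_center A t $ 2)"
proof -
  define c where "c = min (cos s) (cos t)"
  have c: "0 < c"
    using assms by (simp add: c_def cos_pos)
  have "c * (\<Sum>i<n. dist (rightmost A (r i)) (rightmost A (r (Suc i))))
    \<le> tangent 0 \<bullet> (support_center A t - support_center A s)"
    if "mono_on {..n} r" "r ` {..n} \<subseteq> {support_center A s $ 2..support_center A t $ 2}" for n r
    by (rule sum_dist_rightmost[OF assms _ _ _ that]) (use c in \<open>auto simp: c_def\<close>)
  then show ?thesis
    unfolding bounded_variation_def
    by (intro exI[of _ "(tangent 0 \<bullet> (support_center A t - support_center A s)) / c"])
      (simp add: pos_le_divide_eq[OF c] mult.commute)
qed

lemma variation_rightmost_le:
  assumes "\<bar>s\<bar> < \<theta>" "\<bar>t\<bar> < \<theta>" "s < t"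
    and "0 < c" "c \<le> cos (m - s)" "c \<le> cos (t - m)"
  shows "c * variation (rightmost A) (support_center A s $ 2) (support_center A t $ 2)
    \<le> tangent m \<bullet> (support_center A t - support_center A s)"
proof -
  have "variation (rightmost A) (support_center A s $ 2) (support_center A t $ 2)
    \<le> (tangent m \<bullet> (support_center A t - support_center A s)) / c"
    using sum_dist_rightmost[OF assms(1-3) less_imp_le[OF assms(4)] assms(5,6)]
    by (intro variation_le support_center_height_mono)
      (use assms in \<open>auto simp: pos_le_divide_eq[OF assms(4)] mult.commute\<close>)
  then show ?thesis
    by (simp add: pos_le_divide_eq[OF assms(4)] mult.commute)
qed

section \<open>Boundary arcs between support centers\<close>

lemma rightmost_in_frontier:
  assumes "a \<in> A"
  shows "rightmost A (a $ 2) \<in> frontier A"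
proof -
  let ?g = "rightmost A (a $ 2)"
  have "?g \<notin> interior A"
  proof
    assume "?g \<in> interior A"
    then obtain e where e: "0 < e" "ball ?g e \<subseteq> A"
      by (meson mem_interior)
    define b where "b = ?g + (e / 2) *\<^sub>R direction 0"
    have "b \<in> A"
      using e by (intro subsetD[OF e(2)]) (simp add: b_def dist_norm)
    moreover have "b $ 2 = a $ 2" "b $ 1 = ?g $ 1 + e / 2"
      using rightmost(2)[OF assms] by (simp_all add: b_def)
    ultimately show False
      using rightmost(3)[of b] e(1) by simp
  qed
  then show ?thesis
    using rightmost(1)[OF assms] closure_subset by (auto simp: frontier_def)
qed

text \<open>
A supporting line at a frontier point strictly between two heights of \<open>A\<close> cannot be horizontal, so
no point of \<open>A\<close> at the same height lies further to the right. At an extreme height of \<open>A\<close> this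
can fail: there the frontier may contain a whole horizontal ray.
\<close>

lemma frontier_eq_rightmost:
  assumes "x \<in> frontier A" "p \<in> A" "q \<in> A" "p $ 2 < x $ 2" "x $ 2 < q $ 2"
  shows "x = rightmost A (x $ 2)"
proof -
  have "x \<in> A"
    using assms(1) closed by (simp add: frontier_def)
  note r = rightmost[OF this]
  obtain u where u: "u \<noteq> 0" "\<And>b. b \<in> A \<Longrightarrow> u \<bullet> b \<le> u \<bullet> x"
    using supporting_hyperplane_frontier[OF convex closed assms(1)] by blast
  have "direction pi + x \<in> A"
    using add_mem[OF \<open>x \<in> A\<close>, of 1 pi] \<theta> by simp
  from u(2)[OF this] have "0 \<le> u $ 1"
    by (simp add: inner_real2 algebra_simps)
  moreover have "u $ 1 \<noteq> 0"
  proof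
    assume "u $ 1 = 0"
    then have "u $ 2 * (p $ 2 - x $ 2) \<le> 0" "u $ 2 * (q $ 2 - x $ 2) \<le> 0" "u $ 2 \<noteq> 0"
      using u(2)[OF \<open>p \<in> A\<close>] u(2)[OF \<open>q \<in> A\<close>] u(1)
      by (simp_all add: inner_real2 vec_eq_iff forall_2 algebra_simps)
    then show False
      using assms(4,5) by (simp add: mult_le_0_iff)
  qed
  moreover have "u $ 1 * rightmost A (x $ 2) $ 1 \<le> u $ 1 * x $ 1"
    using u(2)[OF r(1)] r(2) by (simp add: inner_real2)
  ultimately show ?thesis
    using r by (simp add: vec_eq_iff forall_2)
qed

lemma continuous_on_rightmost:
  assumes "\<bar>s\<bar> < \<theta>" "\<bar>t\<bar> < \<theta>" "s < t"
  shows "continuous_on {support_center A s $ 2..support_center A t $ 2} (rightmost A)"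
proof -
  let ?g = "rightmost A" and ?y = "\<lambda>t. support_center A t $ 2"
  define c where "c = min (cos s) (cos t)"
  have c: "0 < c" "c \<le> cos s" "c \<le> cos t"
    using assms by (simp_all add: c_def cos_pos)
  have height: "?g y $ 2 = y" if "?y s \<le> y" "y \<le> ?y t" for y
    using heights_interval[OF support_center_in[OF assms(1)] support_center_in[OF assms(2)] that]
      rightmost(2) by metis
  have le: "dist (?g y') (?g y) \<le> (1 / c) * dist y' y"
    if "?y s \<le> y" "y \<le> y'" "y' \<le> ?y t" for y y'
  proof -
    have "c * norm (?g y' - ?g y) \<le> tangent 0 \<bullet> (?g y' - ?g y)"
      using that c by (intro norm_rightmost_diff[OF assms]) auto
    also have "\<dots> = y' - y"
      using that by (simp add: inner_real2 height)
    finally show ?thesis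
      using c(1) that by (simp add: dist_norm field_simps)
  qed
  have "(1 / c)-lipschitz_on {?y s..?y t} ?g"
  proof (rule lipschitz_onI)
    fix y y' assume "y \<in> {?y s..?y t}" "y' \<in> {?y s..?y t}"
    then show "dist (?g y) (?g y') \<le> 1 / c * dist y y'"
      using le[of y y'] le[of y' y] by (cases "y \<le> y'") (auto simp: dist_commute)
  qed (use c(1) in simp)
  then show ?thesis
    by (rule lipschitz_on_continuous_on)
qed

lemma rightmost_height:
  assumes "\<bar>s\<bar> < \<theta>" "\<bar>t\<bar> < \<theta>" "y \<in> {support_center A s $ 2..support_center A t $ 2}"
  shows "rightmost A y $ 2 = y" "rightmost A y \<in> frontier A"
  using heights_interval[OF support_center_in[OF assms(1)] support_center_in[OF assms(2)], of y]
    rightmost(2) rightmost_in_frontier assms(3) by auto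

text \<open>
The frontier retracts onto the piece of the graph between the two support centers, by clamping the
height, and everything outside this piece is sent to one of its two end points. On an excursion of
the arc outside the piece the retraction is therefore constant, so the excursion would start and
end at the same point, against injectivity. This argument also covers horizontal rays, which the
frontier can contain when the heights of \<open>A\<close> are bounded on one side.
\<close>

lemma boundary_arc_on_graph:
  assumes "\<bar>s\<bar> < \<theta>" "\<bar>t\<bar> < \<theta>" "s < t"
    and g: "arc g" "path_image g \<subseteq> frontier A" "pathstart g = support_center A s"
      "pathfinish g = support_center A t"
    and x: "x \<in> {0..1}"
  shows "g x = rightmost A (g x $ 2) \<and> g x $ 2 \<in> {support_center A s $ 2..support_center A t $ 2}"
proof -
  let ?\<gamma> = "rightmost A"
  define a b where "a = support_center A s $ 2" and "b = support_center A t $ 2"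
  have "a \<le> b"
    unfolding a_def b_def using assms by (intro support_center_height_mono) auto
  define \<rho> where "\<rho> z = ?\<gamma> (max a (min b (z $ 2)))" for z :: "real^2"
  define \<Gamma> where "\<Gamma> = ?\<gamma> ` {a..b}"
  have cont: "continuous_on {a..b} ?\<gamma>"
    unfolding a_def b_def by (rule continuous_on_rightmost[OF assms(1-3)])
  have g_cont: "continuous_on {0..1} g"
    using g(1) by (simp add: arc_def path_def)
  have g_inj: "inj_on g {0..1}"
    using g(1) by (simp add: arc_def)
  have height: "?\<gamma> y $ 2 = y" if "y \<in> {a..b}" for y
    using rightmost_height[OF assms(1,2)] that unfolding a_def b_def by blast
  have ends: "?\<gamma> a = g 0" "?\<gamma> b = g 1"
    using g assms by (simp_all add: a_def b_def support_center_eq_rightmost pathstart_def pathfinish_def)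
  have "compact \<Gamma>"
    unfolding \<Gamma>_def by (intro compact_continuous_image cont compact_Icc)
  have \<rho>_id: "\<rho> z = z" if "z \<in> \<Gamma>" for z
    using that by (auto simp: \<Gamma>_def \<rho>_def height)
  have \<rho>_cont: "continuous_on {0..1} (\<lambda>x. \<rho> (g x))"
    unfolding \<rho>_def using \<open>a \<le> b\<close>
    by (intro continuous_on_compose2[OF cont] continuous_intros g_cont) auto
  have outside: "\<rho> (g x) \<in> {g 0, g 1}" if "x \<in> {0..1}" "g x \<notin> \<Gamma>" for x
  proof -
    have "g x \<in> frontier A"
      using g(2) that(1) by (auto simp: path_image_def)
    then have "\<not> (a < g x $ 2 \<and> g x $ 2 < b)"
      using frontier_eq_rightmost[of "g x" "support_center A s" "support_center A t"] that(2)
        support_center_in assms(1,2)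
      unfolding \<Gamma>_def a_def b_def by (metis atLeastAtMost_iff image_eqI less_imp_le)
    then have "max a (min b (g x $ 2)) = a \<or> max a (min b (g x $ 2)) = b"
      using \<open>a \<le> b\<close> by linarith
    then show ?thesis
      by (auto simp: \<rho>_def ends)
  qed
  have "g x \<in> \<Gamma>"
  proof (rule ccontr)
    assume "g x \<notin> \<Gamma>"
    define T where "T = {0..1} \<inter> g -` \<Gamma>"
    have "closed T"
      unfolding T_def using \<open>compact \<Gamma>\<close>
      by (intro continuous_closed_preimage g_cont) (auto intro: compact_imp_closed)
    have "0 \<in> T" "1 \<in> T"
      using \<open>a \<le> b\<close> by (auto simp: T_def \<Gamma>_def ends[symmetric])
    have "x \<notin> T" "0 \<le> x" "x \<le> 1"
      using \<open>g x \<notin> \<Gamma>\<close> x by (auto simp: T_def)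
    \<comment> \<open>the maximal excursion around \<open>x\<close> takes place over the interval from \<open>l\<close> to \<open>r\<close>\<close>
    define l r where "l = Sup (T \<inter> {0..x})" and "r = Inf (T \<inter> {x..1})"
    have "l \<in> T \<inter> {0..x}"
      unfolding l_def using \<open>closed T\<close> \<open>0 \<in> T\<close> \<open>0 \<le> x\<close>
      by (intro closed_contains_Sup closed_Int closed_atLeastAtMost) auto
    have "r \<in> T \<inter> {x..1}"
      unfolding r_def using \<open>closed T\<close> \<open>1 \<in> T\<close> \<open>x \<le> 1\<close>
      by (intro closed_contains_Inf closed_Int closed_atLeastAtMost) auto
    have "l < x" "x < r" and l: "l \<in> T" "0 \<le> l" and r: "r \<in> T" "r \<le> 1"
      using \<open>l \<in> T \<inter> {0..x}\<close> \<open>r \<in> T \<inter> {x..1}\<close> \<open>x \<notin> T\<close> by (auto simp: order_less_le)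
    have gap: "w \<notin> T" if "l < w" "w < r" for w
    proof
      assume "w \<in> T"
      show False
      proof (cases "w \<le> x")
        case True
        then have "w \<le> l"
          unfolding l_def using \<open>w \<in> T\<close> l that by (intro cSup_upper) auto
        then show False using that by simp
      next
        case False
        then have "r \<le> w"
          unfolding r_def using \<open>w \<in> T\<close> r that by (intro cInf_lower) auto
        then show False using that by simp
      qed
    qed
    have sub: "(\<lambda>x. \<rho> (g x)) ` {l..r} \<subseteq> {g 0, g 1}"
    proof -
      have "(\<lambda>x. \<rho> (g x)) ` closure {l<..<r} \<subseteq> {g 0, g 1}"
      proof (rule image_closure_subset)
        show "continuous_on (closure {l<..<r}) (\<lambda>x. \<rho> (g x))"
          using \<open>l < x\<close> \<open>x < r\<close> l r by (intro continuous_on_subset[OF \<rho>_cont]) auto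
        show "(\<lambda>x. \<rho> (g x)) ` {l<..<r} \<subseteq> {g 0, g 1}"
        proof
          fix z assume "z \<in> (\<lambda>x. \<rho> (g x)) ` {l<..<r}"
          then obtain w where w: "z = \<rho> (g w)" "l < w" "w < r" by auto
          then have "w \<in> {0..1}" "g w \<notin> \<Gamma>"
            using gap[of w] l r by (auto simp: T_def)
          then show "z \<in> {g 0, g 1}"
            using outside w(1) by blast
        qed
      qed simp
      then show ?thesis
        using \<open>l < x\<close> \<open>x < r\<close> by simp
    qed
    have "continuous_on {l..r} (\<lambda>x. \<rho> (g x))"
      using l r by (intro continuous_on_subset[OF \<rho>_cont]) auto
    then have "connected ((\<lambda>x. \<rho> (g x)) ` {l..r})"
      by (intro connected_continuous_image) auto
    moreover have "finite ((\<lambda>x. \<rho> (g x)) ` {l..r})"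
      using sub by (rule finite_subset) simp
    ultimately obtain z where "(\<lambda>x. \<rho> (g x)) ` {l..r} \<subseteq> {z}"
      using connected_finite_iff_sing by (metis empty_subsetI order_refl)
    then have "\<rho> (g l) = \<rho> (g r)"
      using \<open>l < x\<close> \<open>x < r\<close> by (auto simp: image_subset_iff)
    moreover have "\<rho> (g l) = g l" "\<rho> (g r) = g r"
      using l(1) r(1) by (auto simp: T_def intro!: \<rho>_id)
    ultimately have "g l = g r"
      by simp
    then have "l = r"
      using l r \<open>l < x\<close> \<open>x < r\<close> by (intro inj_onD[OF g_inj]) auto
    then show False
      using \<open>l < x\<close> \<open>x < r\<close> by simp
  qed
  then show ?thesis
    using height by (auto simp: \<Gamma>_def a_def b_def)
qed

text \<open>
The height along such an arc is a strictly increasing reparametrization, so the length depends on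
the piece of the graph only. This is what makes the definite description in the
definition of the boundary arc length meaningful.
\<close>

lemma path_length_boundary_arc:
  assumes "\<bar>s\<bar> < \<theta>" "\<bar>t\<bar> < \<theta>" "s < t"
    and g: "arc g" "path_image g \<subseteq> frontier A" "pathstart g = support_center A s"
      "pathfinish g = support_center A t"
  shows "path_length g = variation (rightmost A) (support_center A s $ 2) (support_center A t $ 2)"
  unfolding path_length_eq_variation
proof (rule variation_reparametrize)
  define \<sigma> where "\<sigma> x = g x $ 2" for x
  let ?a = "support_center A s $ 2" and ?b = "support_center A t $ 2"
  note graph = boundary_arc_on_graph[OF assms]
  show "g x = rightmost A (g x $ 2)" if "x \<in> {0..1}" for x
    using graph[OF that] by simp
  have g_cont: "continuous_on {0..1} g"
    using g(1) by (simp add: arc_def path_def)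
  have cont: "continuous_on {0..1} \<sigma>"
    unfolding \<sigma>_def by (intro continuous_intros g_cont)
  have inj: "inj_on \<sigma> {0..1}"
  proof (rule inj_onI)
    fix x y :: real assume xy: "x \<in> {0..1}" "y \<in> {0..1}" "\<sigma> x = \<sigma> y"
    then have "g x = g y"
      using graph[OF xy(1)] graph[OF xy(2)] unfolding \<sigma>_def by metis
    then show "x = y"
      using g(1) xy by (auto simp: arc_def inj_on_def)
  qed
  have \<sigma>01: "\<sigma> 0 = ?a" "\<sigma> 1 = ?b"
    using g by (simp_all add: \<sigma>_def pathstart_def pathfinish_def)
  have ab: "?a < ?b"
    using support_center_height_mono[of s t] assms(1-3) inj_onD[OF inj, of 0 1] \<sigma>01 by force
  have *: "\<sigma> x < \<sigma> 1" if "0 \<le> x" "x < 1" for x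
    using continuous_inj_imp_mono[of 0 x 1 \<sigma>] cont inj that \<sigma>01 ab by (cases "x = 0") auto
  have "\<sigma> x < \<sigma> y" if "0 \<le> x" "x < y" "y \<le> 1" for x y
  proof (cases "y = 1")
    case False
    have "continuous_on {x..1} \<sigma>" "inj_on \<sigma> {x..1}"
      using that cont inj by (auto intro: continuous_on_subset inj_on_subset)
    then show ?thesis
      using continuous_inj_imp_mono[of x y 1 \<sigma>] that False *[of x] by force
  qed (use * that in auto)
  then show "strict_mono_on {0..1} (\<lambda>x. g x $ 2)"
    by (auto simp: \<sigma>_def strict_mono_on_def)
  show "(\<lambda>x. g x $ 2) ` {0..1} = {?a..?b}"
  proof (intro equalityI subsetI)
    fix y assume "y \<in> (\<lambda>x. g x $ 2) ` {0..1}"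
    then show "y \<in> {?a..?b}" using graph by blast
  next
    fix y assume "y \<in> {?a..?b}"
    then obtain x where "0 \<le> x" "x \<le> 1" "\<sigma> x = y"
      using IVT'[of \<sigma> 0 y 1] cont \<sigma>01 by auto
    then show "y \<in> (\<lambda>x. g x $ 2) ` {0..1}"
      by (auto simp: \<sigma>_def)
  qed
qed

lemma boundary_arc_exists:
  assumes "\<bar>s\<bar> < \<theta>" "\<bar>t\<bar> < \<theta>" "s < t" "support_center A s \<noteq> support_center A t"
  shows "\<exists>g. arc g \<and> path_image g \<subseteq> frontier A \<and> pathstart g = support_center A s \<and>
    pathfinish g = support_center A t"
proof -
  let ?a = "support_center A s $ 2" and ?b = "support_center A t $ 2"
  define g where "g x = rightmost A (linepath ?a ?b x)" for x
  have ab: "?a < ?b"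
  proof -
    have "?a \<noteq> ?b"
      using support_center_eq_rightmost[OF assms(1)] support_center_eq_rightmost[OF assms(2)]
        assms(4) by metis
    then show ?thesis
      using support_center_height_mono[OF assms(1,2)] assms(3) by simp
  qed
  have line: "linepath ?a ?b x \<in> {?a..?b}" if "x \<in> {0..1}" for x
    using linepath_in_path[OF that, of ?a ?b] ab by (simp add: closed_segment_eq_real_ivl)
  have "continuous_on {0..1} g"
    unfolding g_def using line
    by (intro continuous_on_compose2[OF continuous_on_rightmost[OF assms(1-3)]]) auto
  moreover have "inj_on g {0..1}"
  proof (rule inj_onI)
    fix x y :: real assume xy: "x \<in> {0..1}" "y \<in> {0..1}" "g x = g y"
    then have "linepath ?a ?b x = linepath ?a ?b y"
      using rightmost_height(1)[OF assms(1,2) line[OF xy(1)]]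
        rightmost_height(1)[OF assms(1,2) line[OF xy(2)]] unfolding g_def by metis
    then have "(x - y) * (?b - ?a) = 0"
      by (simp add: linepath_def algebra_simps)
    then show "x = y" using ab by simp
  qed
  moreover have "path_image g \<subseteq> frontier A"
    using rightmost_height(2)[OF assms(1,2) line] by (auto simp: path_image_def g_def)
  moreover have "g 0 = support_center A s" "g 1 = support_center A t"
    using support_center_eq_rightmost assms(1,2) by (simp_all add: g_def linepath_def)
  ultimately show ?thesis
    unfolding arc_def path_def pathstart_def pathfinish_def by blast
qed

lemma boundary_arc_length_eq_variation:
  assumes "\<bar>s\<bar> < \<theta>" "\<bar>t\<bar> < \<theta>" "s < t"
  shows "boundary_arc_length A (support_center A s) (support_center A t) =
    variation (rightmost A) (support_center A s $ 2) (support_center A t $ 2)"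
proof (cases "support_center A s = support_center A t")
  case True
  have "variation (rightmost A) (support_center A t $ 2) (support_center A t $ 2) = 0"
    using variation_add[OF bounded_variation_subset[OF bounded_variation_rightmost[OF assms],
        of "support_center A t $ 2" "support_center A t $ 2"], of "support_center A t $ 2"]
      True by simp
  then show ?thesis
    using True by (simp add: boundary_arc_length_def)
next
  case False
  obtain g where g: "arc g" "path_image g \<subseteq> frontier A" "pathstart g = support_center A s"
    "pathfinish g = support_center A t"
    using boundary_arc_exists[OF assms False] by blast
  have "(THE l. \<exists>g. arc g \<and> path_image g \<subseteq> frontier A \<and> pathstart g = support_center A s \<and>
      pathfinish g = support_center A t \<and> l = path_length g) =
    variation (rightmost A) (support_center A s $ 2) (support_center A t $ 2)"
  proof (rule the_equality)
    show "\<exists>g. arc g \<and> path_image g \<subseteq> frontier A \<and> pathstart g = support_center A s \<and>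
        pathfinish g = support_center A t \<and>
        variation (rightmost A) (support_center A s $ 2) (support_center A t $ 2) = path_length g"
      using g path_length_boundary_arc[OF assms g] by (intro exI[of _ g]) simp
  qed (elim exE conjE, simp only: path_length_boundary_arc[OF assms])
  then show ?thesis
    using False by (simp add: boundary_arc_length_def)
qed

section \<open>Support centers and the arc-length function\<close>

lemma arc_length_function_diff:
  assumes "\<bar>s\<bar> < \<theta>" "\<bar>t\<bar> < \<theta>" "s < t"
  shows "arc_length_function A t - arc_length_function A s =
    variation (rightmost A) (support_center A s $ 2) (support_center A t $ 2)"
proof -
  let ?y = "\<lambda>t. support_center A t $ 2"
  have add: "variation (rightmost A) (?y a) (?y c) =
      variation (rightmost A) (?y a) (?y b) + variation (rightmost A) (?y b) (?y c)"
    if "\<bar>a\<bar> < \<theta>" "\<bar>c\<bar> < \<theta>" "a < b" "b < c" for a b c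
    using that by (intro variation_add bounded_variation_rightmost support_center_height_mono) auto
  have pos: "arc_length_function A r = variation (rightmost A) (?y 0) (?y r)"
    if "0 < r" "r < \<theta>" for r
    using boundary_arc_length_eq_variation[of 0 r] that by (simp add: arc_length_function_def)
  have neg: "arc_length_function A r = - variation (rightmost A) (?y r) (?y 0)"
    if "r < 0" "- \<theta> < r" for r
    using boundary_arc_length_eq_variation[of r 0] that
    by (simp add: arc_length_function_def boundary_arc_length_commute)
  have zero: "arc_length_function A 0 = 0"
    by (simp add: arc_length_function_def boundary_arc_length_def)
  consider "0 < s" | "s = 0" | "s < 0" "0 < t" | "t = 0" | "t < 0"
    by linarith
  then show ?thesis
  proof cases
    case 1
    then show ?thesis using add[of 0 t s] pos[of s] pos[of t] assms by simp
  next
    case 2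
    then show ?thesis using pos[of t] zero assms by simp
  next
    case 3
    then show ?thesis using add[of s t 0] pos[of t] neg[of s] assms by simp
  next
    case 4
    then show ?thesis using neg[of s] zero assms by simp
  next
    case 5
    then show ?thesis using add[of s 0 t] neg[of s] neg[of t] assms by simp
  qed
qed

lemma arc_length_function_mono:
  assumes "\<bar>s\<bar> < \<theta>" "\<bar>t\<bar> < \<theta>" "s \<le> t"
  shows "arc_length_function A s \<le> arc_length_function A t"
proof (cases "s = t")
  case False
  then have "s < t" using assms(3) by simp
  have "0 \<le> dist (rightmost A (support_center A s $ 2)) (rightmost A (support_center A t $ 2))"
    by simp
  also have "\<dots> \<le> arc_length_function A t - arc_length_function A s"
    unfolding arc_length_function_diff[OF assms(1,2) \<open>s < t\<close>]
    by (intro dist_le_variation bounded_variation_rightmost support_center_height_mono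
        assms \<open>s < t\<close>)
  finally show ?thesis by simp
qed simp

text \<open>
The differential relation between a boundary and its arc length, with a quantitative error: the
velocity is the unit tangent. The chord is at most as long as the arc, and its tangential component is
at least \<open>cos (t - s)\<close> times the length of the arc, which leaves only an error of relative order \<open>t - s\<close>.
\<close>

lemma support_center_increment:
  assumes "\<bar>s\<bar> < \<theta>" "\<bar>t\<bar> < \<theta>" "s < t" "t - s \<le> 1"
  shows "norm (support_center A t - support_center A s
      - (arc_length_function A t - arc_length_function A s) *\<^sub>R tangent s)
    \<le> 2 * (t - s) * (arc_length_function A t - arc_length_function A s)"
proof -
  define x where "x = support_center A t - support_center A s"
  define l where "l = arc_length_function A t - arc_length_function A s"
  define \<delta> where "\<delta> = t - s"
  have l: "l = variation (rightmost A) (support_center A s $ 2) (support_center A t $ 2)"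
    using arc_length_function_diff[OF assms(1-3)] by (simp add: l_def)
  have "0 < \<delta>" "\<delta> \<le> 1"
    using assms(3,4) by (simp_all add: \<delta>_def)
  have cos0: "0 < cos \<delta>"
    using \<open>0 < \<delta>\<close> \<open>\<delta> \<le> 1\<close> pi_gt3 by (intro cos_gt_zero_pi) linarith+
  have cos1: "1 - \<delta>\<^sup>2 / 2 \<le> cos \<delta>"
  proof -
    have "(sin (\<delta> / 2))\<^sup>2 \<le> (\<delta> / 2)\<^sup>2"
      using abs_sin_x_le_abs_x by (rule abs_le_square_iff[THEN iffD1])
    then show ?thesis
      using cos_double_sin[of "\<delta> / 2"] by (simp add: power2_eq_square)
  qed
  have xl: "norm x \<le> l"
    using dist_le_variation[OF bounded_variation_rightmost[OF assms(1-3)]]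
      support_center_height_mono[of s t] assms
    by (simp add: l x_def support_center_eq_rightmost dist_norm norm_minus_commute)
  then have "0 \<le> l" using norm_ge_zero order_trans by blast
  have lx: "cos \<delta> * l \<le> tangent s \<bullet> x"
    using variation_rightmost_le[OF assms(1-3), of "cos \<delta>" s] cos0 by (simp add: l x_def \<delta>_def)
  have "(norm (x - l *\<^sub>R tangent s))\<^sup>2 = (norm x)\<^sup>2 + l\<^sup>2 - 2 * l * (tangent s \<bullet> x)"
  proof -
    have "(norm (x - l *\<^sub>R tangent s))\<^sup>2 = x \<bullet> x + l * l - 2 * l * (tangent s \<bullet> x)"
      unfolding power2_norm_eq_inner
      by (simp add: inner_diff_left inner_diff_right inner_direction inner_commute[of x "tangent s"] algebra_simps)
    then show ?thesis
      by (simp only: power2_norm_eq_inner) (simp add: power2_eq_square)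
  qed
  also have "\<dots> \<le> l\<^sup>2 + l\<^sup>2 - 2 * l * ((1 - \<delta>\<^sup>2 / 2) * l)"
  proof -
    have "(norm x)\<^sup>2 \<le> l\<^sup>2"
      using xl by (intro power_mono) auto
    moreover have "(1 - \<delta>\<^sup>2 / 2) * l \<le> tangent s \<bullet> x"
      using mult_right_mono[OF cos1 \<open>0 \<le> l\<close>] lx by linarith
    then have "l * ((1 - \<delta>\<^sup>2 / 2) * l) \<le> l * (tangent s \<bullet> x)"
      using \<open>0 \<le> l\<close> by (intro mult_left_mono)
    ultimately show ?thesis by linarith
  qed
  also have "\<dots> = (\<delta> * l)\<^sup>2"
    by (simp add: algebra_simps power2_eq_square)
  finally have "norm (x - l *\<^sub>R tangent s) \<le> \<delta> * l"
    by (rule power2_le_imp_le) (use \<open>0 < \<delta>\<close> \<open>0 \<le> l\<close> in simp)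
  also have "\<dots> \<le> 2 * \<delta> * l"
    using \<open>0 < \<delta>\<close> \<open>0 \<le> l\<close> by simp
  finally show ?thesis
    unfolding x_def l_def \<delta>_def .
qed

end

section \<open>Minkowski sums and summands\<close>

context angle_recession
begin

lemma inner_support_center_increment:
  assumes "\<bar>s\<bar> < \<theta>" "\<bar>t\<bar> < \<theta>" "s < t" "t - s \<le> 1" "norm v = 1"
  shows "\<bar>v \<bullet> (support_center A t - support_center A s)
      - (arc_length_function A t - arc_length_function A s) * (v \<bullet> tangent s)\<bar>
    \<le> 2 * (t - s) * (arc_length_function A t - arc_length_function A s)"
proof -
  let ?x = "support_center A t - support_center A s
      - (arc_length_function A t - arc_length_function A s) *\<^sub>R tangent s"
  have "\<bar>v \<bullet> ?x\<bar> \<le> norm ?x"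
    using Cauchy_Schwarz_ineq2[of v ?x] assms(5) by simp
  also have "\<dots> \<le> 2 * (t - s) * (arc_length_function A t - arc_length_function A s)"
    by (rule support_center_increment[OF assms(1-4)])
  finally show ?thesis
    by (simp add: inner_diff_right)
qed

text \<open>
Near a given point of the closure only a compact part of \<open>A\<close> is involved: if \<open>a + c\<close> stays near
the point while \<open>direction 0\<close> is bounded above on \<open>C\<close>, then it is bounded below at \<open>a\<close>, and such
superlevel sets of \<open>A\<close> are bounded.
\<close>

lemma closed_sum:
  assumes "closed C" "\<And>c. c \<in> C \<Longrightarrow> direction 0 \<bullet> c \<le> M"
  shows "closed (A + C)"
proof -
  have "x \<in> A + C" if x: "x \<in> closure (A + C)" for x
  proof -
    define K where "K = {a \<in> A. direction 0 \<bullet> x - 1 - M \<le> direction 0 \<bullet> a}"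
    have "K = A \<inter> {a. direction 0 \<bullet> x - 1 - M \<le> direction 0 \<bullet> a}"
      by (auto simp: K_def)
    moreover have "closed (A \<inter> {a. direction 0 \<bullet> x - 1 - M \<le> direction 0 \<bullet> a})"
      by (intro closed_Int closed closed_halfspace_ge)
    ultimately have "closed K"
      by simp
    moreover have "bounded K"
      unfolding K_def using \<theta> by (intro bounded_superlevel) simp
    ultimately have "compact K"
      by (simp add: compact_eq_bounded_closed)
    moreover have "K + C = (\<Union>x\<in>K. \<Union>y\<in>C. {x + y})"
      by (auto simp: set_plus_def)
    ultimately have "closed (K + C)"
      using compact_closed_sums[of K C] \<open>closed C\<close> by simp
    have "ball x 1 \<inter> (A + C) \<subseteq> K + C"
    proof
      fix z assume "z \<in> ball x 1 \<inter> (A + C)"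
      then obtain a c where z: "z = a + c" "a \<in> A" "c \<in> C" "norm (x - z) < 1"
        by (auto simp: set_plus_def dist_norm)
      have "direction 0 \<bullet> (x - z) \<le> 1"
        using Cauchy_Schwarz_ineq2[of "direction 0" "x - z"] z(4) by simp
      then have "a \<in> K"
        using z assms(2)[OF z(3)] by (simp add: K_def inner_diff_right inner_add_right)
      then show "z \<in> K + C"
        using z by (auto simp: set_plus_def)
    qed
    then have "closure (ball x 1 \<inter> (A + C)) \<subseteq> K + C"
      using \<open>closed (K + C)\<close> by (rule closure_minimal)
    moreover have "x \<in> closure (ball x 1 \<inter> (A + C))"
      using open_Int_closure_subset[of "ball x 1" "A + C"] x by auto
    ultimately have "x \<in> K + C" by blast
    then show "x \<in> A + C"
      by (auto simp: set_plus_def K_def)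
  qed
  then show ?thesis
    by (metis closure_subset_eq subsetI)
qed

end

text \<open>
Support sets add under Minkowski sums, and so do their end points in the tangential direction. The
difference of the centers is thus the midpoint of two points of the support set of \<open>C\<close>.
\<close>

lemma support_center_diff_in_summand:
  assumes A: "angle_recession \<theta> A" and B: "angle_recession \<theta> B" and BAC: "B = A + C"
    and "convex C" and t: "\<bar>t\<bar> < \<theta>"
  shows "support_center B t - support_center A t \<in> support_set C (direction t)"
proof -
  interpret A: angle_recession \<theta> A by fact
  interpret B: angle_recession \<theta> B by fact
  let ?u = "direction t"
  have memB: "a + c \<in> B" if "a \<in> A" "c \<in> C" for a c
    using that BAC by (auto simp: set_plus_def)
  have split: "\<exists>a c. x = a + c \<and> a \<in> support_set A ?u \<and> c \<in> support_set C ?u"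
    if x: "x \<in> support_set B ?u" for x
  proof -
    obtain a c where ac: "x = a + c" "a \<in> A" "c \<in> C"
      using x BAC by (auto simp: support_set_def set_plus_def)
    have max: "?u \<bullet> b \<le> ?u \<bullet> (a + c)" if "b \<in> B" for b
      using x that by (simp add: support_set_def ac)
    have "?u \<bullet> a' \<le> ?u \<bullet> a" if "a' \<in> A" for a'
      using max[OF memB[OF that ac(3)]] by (simp add: inner_add_right)
    moreover have "?u \<bullet> c' \<le> ?u \<bullet> c" if "c' \<in> C" for c'
      using max[OF memB[OF ac(2) that]] by (simp add: inner_add_right)
    ultimately show ?thesis
      using ac by (auto simp: support_set_def)
  qed
  have join: "a + c \<in> support_set B ?u"
    if "a \<in> support_set A ?u" "c \<in> support_set C ?u" for a c
  proof -
    have "?u \<bullet> x \<le> ?u \<bullet> (a + c)" if "x \<in> B" for x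
    proof -
      obtain a' c' where "x = a' + c'" "a' \<in> A" "c' \<in> C"
        using \<open>x \<in> B\<close> unfolding BAC set_plus_def by blast
      then show ?thesis
        using \<open>a \<in> support_set A ?u\<close> \<open>c \<in> support_set C ?u\<close>
        by (simp add: support_set_def inner_add_right add_mono)
    qed
    then show ?thesis
      using that memB by (simp add: support_set_def)
  qed
  have unique: "x = y"
    if "x \<in> support_set A ?u" "y \<in> support_set A ?u" "tangent t \<bullet> x = tangent t \<bullet> y" for x y
  proof -
    have "?u \<bullet> x = ?u \<bullet> y"
      using that by (auto simp: support_set_def intro: antisym)
    then show ?thesis
      using direction_tangent_decomposition[of x t] direction_tangent_decomposition[of y t] that(3)
      by metis
  qed
  obtain p q where pq: "p \<in> support_set A ?u" "q \<in> support_set A ?u"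
    "support_center A t = midpoint p q"
    "\<And>x. x \<in> support_set A ?u \<Longrightarrow> tangent t \<bullet> p \<le> tangent t \<bullet> x"
    "\<And>x. x \<in> support_set A ?u \<Longrightarrow> tangent t \<bullet> x \<le> tangent t \<bullet> q"
    using A.support_segment[OF t] by metis
  obtain p' q' where pq': "p' \<in> support_set B ?u" "q' \<in> support_set B ?u"
    "support_center B t = midpoint p' q'"
    "\<And>x. x \<in> support_set B ?u \<Longrightarrow> tangent t \<bullet> p' \<le> tangent t \<bullet> x"
    "\<And>x. x \<in> support_set B ?u \<Longrightarrow> tangent t \<bullet> x \<le> tangent t \<bullet> q'"
    using B.support_segment[OF t] by metis
  obtain a c where ac: "p' = a + c" "a \<in> support_set A ?u" "c \<in> support_set C ?u"
    using split[OF pq'(1)] by blast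
  obtain a' c' where ac': "q' = a' + c'" "a' \<in> support_set A ?u" "c' \<in> support_set C ?u"
    using split[OF pq'(2)] by blast
  have "a = p"
    using pq'(4)[OF join[OF pq(1) ac(3)]] pq(4)[OF ac(2)]
    by (intro unique ac(2) pq(1)) (simp add: ac(1) inner_add_right)
  have "a' = q"
    using pq'(5)[OF join[OF pq(2) ac'(3)]] pq(5)[OF ac'(2)]
    by (intro unique ac'(2) pq(2)) (simp add: ac'(1) inner_add_right)
  have "support_center B t - support_center A t = (1 / 2) *\<^sub>R c + (1 / 2) *\<^sub>R c'"
    by (simp add: pq(3) pq'(3) ac(1) ac'(1) \<open>a = p\<close> \<open>a' = q\<close> midpoint_def algebra_simps)
  moreover have "(1 / 2) *\<^sub>R c + (1 / 2) *\<^sub>R c' \<in> C"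
    using ac(3) ac'(3) by (intro convexD[OF \<open>convex C\<close>]) (auto simp: support_set_def)
  moreover have "?u \<bullet> c = ?u \<bullet> c'"
    using ac(3) ac'(3) by (auto simp: support_set_def intro: antisym)
  ultimately show ?thesis
    using ac(3) by (simp add: support_set_def inner_add_right)
qed

text \<open>
Over a uniform partition into \<open>n\<close> steps the errors add up to \<open>(b - a) / n\<close> times the total increase
of \<open>F\<close>, which tends to zero. This replaces Stieltjes integration against the arc-length function.
\<close>

lemma mono_from_small_errors:
  fixes \<phi> F :: "real \<Rightarrow> real"
  assumes "a \<le> b" "0 < d"
    and step: "\<And>s t. a \<le> s \<Longrightarrow> s < t \<Longrightarrow> t \<le> b \<Longrightarrow> t - s \<le> d \<Longrightarrow> - ((t - s) * (F t - F s)) \<le> \<phi> t - \<phi> s"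
  shows "\<phi> a \<le> \<phi> b"
proof (cases "a = b")
  case False
  then have "a < b" using \<open>a \<le> b\<close> by simp
  have bound: "- ((b - a) / real n * (F b - F a)) \<le> \<phi> b - \<phi> a"
    if n: "n > 0" "(b - a) / real n \<le> d" for n
  proof -
    define h where "h = (b - a) / real n"
    define x where "x i = a + real i * h" for i
    have "0 < h" using \<open>a < b\<close> n by (simp add: h_def)
    have xn: "x n = b" "x 0 = a" using n by (simp_all add: x_def h_def)
    have diff: "x (Suc i) - x i = h" for i
      by (simp add: x_def algebra_simps)
    have "- (h * (F (x (Suc i)) - F (x i))) \<le> \<phi> (x (Suc i)) - \<phi> (x i)" if "i < n" for i
    proof -
      have "real (Suc i) * h \<le> real n * h"
        using that \<open>0 < h\<close> by (intro mult_right_mono) auto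
      then have "x (Suc i) \<le> b"
        using xn by (simp add: x_def)
      moreover have "a \<le> x i"
        using \<open>0 < h\<close> by (simp add: x_def)
      ultimately have "- ((x (Suc i) - x i) * (F (x (Suc i)) - F (x i))) \<le> \<phi> (x (Suc i)) - \<phi> (x i)"
        using diff[of i] \<open>0 < h\<close> n(2) by (intro step) (simp_all add: h_def)
      then show ?thesis
        by (simp only: diff)
    qed
    then have "(\<Sum>i<n. - (h * (F (x (Suc i)) - F (x i)))) \<le> (\<Sum>i<n. \<phi> (x (Suc i)) - \<phi> (x i))"
      by (intro sum_mono) simp
    also have "\<dots> = \<phi> b - \<phi> a"
      using sum_lessThan_telescope[of "\<lambda>i. \<phi> (x i)" n] by (simp add: xn)
    also have "(\<Sum>i<n. - (h * (F (x (Suc i)) - F (x i)))) = - (h * (F b - F a))"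
      using sum_lessThan_telescope[of "\<lambda>i. F (x i)" n]
      by (simp add: xn sum_negf flip: sum_distrib_left)
    finally show ?thesis by (simp add: h_def)
  qed
  have lim: "(\<lambda>n. (b - a) / real n) \<longlonglongrightarrow> 0"
    by (rule lim_const_over_n)
  then have "\<forall>\<^sub>F n in sequentially. (b - a) / real n < d"
    using \<open>0 < d\<close> by (rule order_tendstoD)
  then have ev: "\<forall>\<^sub>F n in sequentially. - ((b - a) / real n * (F b - F a)) \<le> \<phi> b - \<phi> a"
    using eventually_gt_at_top[of 0] by eventually_elim (rule bound, simp_all)
  have "(\<lambda>n. - ((b - a) / real n * (F b - F a))) \<longlonglongrightarrow> - (0 * (F b - F a))"
    by (intro tendsto_intros lim)
  from tendsto_upperbound[OF this ev] show ?thesis by simp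
qed simp

text \<open>
The difference of the support centers of \<open>B\<close> and \<open>A\<close> runs through support points of \<open>C\<close>, so its
increments point forwards along the tangent. Hence each short increment of the center of \<open>B\<close>
dominates that of \<open>A\<close> in the tangential direction, and these are the arc lengths up to small errors.
\<close>

lemma summand_imp_mono_arc_length_diff:
  assumes A: "angle_recession \<theta> A" and B: "angle_recession \<theta> B" and BAC: "B = A + C"
    and "convex C" and a: "\<bar>a\<bar> < \<theta>" and b: "\<bar>b\<bar> < \<theta>" and "a \<le> b"
  shows "arc_length_function B a - arc_length_function A a
    \<le> arc_length_function B b - arc_length_function A b"
proof -
  interpret A: angle_recession \<theta> A by fact
  interpret B: angle_recession \<theta> B by fact
  define F where "F t = 2 * (arc_length_function A t + arc_length_function B t)" for t
  have "- ((t - s) * (F t - F s))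
      \<le> (arc_length_function B t - arc_length_function A t) - (arc_length_function B s - arc_length_function A s)"
    if st: "a \<le> s" "s < t" "t \<le> b" "t - s \<le> 1" for s t
  proof -
    have bounds: "\<bar>s\<bar> < \<theta>" "\<bar>t\<bar> < \<theta>" using st a b by auto
    define G where "G r = support_center B r - support_center A r" for r
    have G: "G r \<in> support_set C (direction r)" if "\<bar>r\<bar> < \<theta>" for r
      unfolding G_def by (rule support_center_diff_in_summand[OF A B BAC \<open>convex C\<close> that])
    have "0 * norm (G t - G s) \<le> tangent s \<bullet> (G t - G s)"
    proof (rule cone_inner_tangent)
      show "direction s \<bullet> (G t - G s) \<le> 0" "0 \<le> direction t \<bullet> (G t - G s)"
        using G bounds by (auto simp: support_set_def inner_diff_right)
      show "0 \<le> cos (t - s)"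
        using st pi_gt3 by (intro cos_ge_zero) linarith+
    qed (use st pi_gt3 in auto)
    then have "0 \<le> tangent s \<bullet> (support_center B t - support_center B s)
        - tangent s \<bullet> (support_center A t - support_center A s)"
      by (simp add: G_def inner_diff_right)
    moreover have "tangent s \<bullet> tangent s = 1"
      by (simp add: inner_direction)
    ultimately show ?thesis
      using A.inner_support_center_increment[OF bounds st(2,4), of "tangent s"]
        B.inner_support_center_increment[OF bounds st(2,4), of "tangent s"]
      by (simp add: F_def abs_le_iff algebra_simps)
  qed
  then show ?thesis
    by (rule mono_from_small_errors[OF \<open>a \<le> b\<close> zero_less_one])
qed

text \<open>
Here \<open>G = H\<^sub>B - H\<^sub>A\<close> moves with velocity a nonnegative multiple of the tangent at \<open>s\<close>, and
\<open>direction T \<bullet> tangent s = sin (T - s)\<close> is nonnegative before \<open>T\<close> and nonpositive after it. So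
\<open>direction T\<close> is maximal along \<open>G\<close> at \<open>T\<close>, as it must be if \<open>G T\<close> is to be a support point of a
convex set in that direction.
\<close>

lemma support_center_diff_maximal:
  assumes A: "angle_recession \<theta> A" and B: "angle_recession \<theta> B"
    and mono: "mono_on {-\<theta><..<\<theta>} (\<lambda>t. arc_length_function B t - arc_length_function A t)"
    and r: "\<bar>r\<bar> < \<theta>" and T: "\<bar>T\<bar> < \<theta>"
  shows "direction T \<bullet> (support_center B r - support_center A r)
    \<le> direction T \<bullet> (support_center B T - support_center A T)"
proof -
  interpret A: angle_recession \<theta> A by fact
  interpret B: angle_recession \<theta> B by fact
  define F where "F t = 2 * (arc_length_function A t + arc_length_function B t)" for t
  define g where "g t = direction T \<bullet> (support_center B t - support_center A t)" for t
  define f where "f t = arc_length_function B t - arc_length_function A t" for t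
  have incr: "\<bar>(g t - g s) - (f t - f s) * sin (T - s)\<bar> \<le> (t - s) * (F t - F s)"
    and fmono: "f s \<le> f t"
    if "\<bar>s\<bar> < \<theta>" "\<bar>t\<bar> < \<theta>" "s < t" "t - s \<le> 1" for s t
  proof -
    show "f s \<le> f t"
      using monotone_onD[OF mono, of s t] that by (auto simp: f_def)
    have "direction T \<bullet> tangent s = sin (T - s)"
      by (simp add: inner_direction cos_diff sin_diff cos_add sin_add)
    then show "\<bar>(g t - g s) - (f t - f s) * sin (T - s)\<bar> \<le> (t - s) * (F t - F s)"
      using A.inner_support_center_increment[OF that, of "direction T"]
        B.inner_support_center_increment[OF that, of "direction T"]
      by (simp add: f_def g_def F_def abs_le_iff inner_diff_right algebra_simps)
  qed
  show ?thesis
  proof (cases "r \<le> T")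
    case True
    have "- ((t - s) * (F t - F s)) \<le> g t - g s" if "r \<le> s" "s < t" "t \<le> T" "t - s \<le> 1" for s t
    proof -
      have st: "\<bar>s\<bar> < \<theta>" "\<bar>t\<bar> < \<theta>" using that r T by auto
      have "0 \<le> sin (T - s)"
        using that r T A.\<theta> by (intro sin_ge_zero) linarith+
      then have "0 \<le> (f t - f s) * sin (T - s)"
        using fmono[OF st that(2,4)] by (intro mult_nonneg_nonneg) simp_all
      then show ?thesis
        using incr[OF st that(2,4)] by linarith
    qed
    then have "g r \<le> g T"
      by (rule mono_from_small_errors[OF True zero_less_one])
    then show ?thesis by (simp add: g_def)
  next
    case False
    then have "T \<le> r" by simp
    have "- ((t - s) * (F t - F s)) \<le> (- g t) - (- g s)"
      if "T \<le> s" "s < t" "t \<le> r" "t - s \<le> 1" for s t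
    proof -
      have st: "\<bar>s\<bar> < \<theta>" "\<bar>t\<bar> < \<theta>" using that r T by auto
      have "0 \<le> sin (s - T)"
        using that r T A.\<theta> by (intro sin_ge_zero) linarith+
      then have "sin (T - s) \<le> 0"
        using sin_minus[of "s - T"] by simp
      then have "(f t - f s) * sin (T - s) \<le> 0"
        using fmono[OF st that(2,4)] by (intro mult_nonneg_nonpos) simp_all
      then show ?thesis
        using incr[OF st that(2,4)] by linarith
    qed
    then have "- g T \<le> - g r"
      by (rule mono_from_small_errors[OF \<open>T \<le> r\<close> zero_less_one])
    then show ?thesis by (simp add: g_def)
  qed
qed

text \<open>
The summand is the Minkowski difference, the largest candidate. It contains all differences
of support centers of \<open>B\<close> and \<open>A\<close>, by the preceding lemma and the fact that \<open>B\<close> is cut out by its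
supporting half-planes with angle in the open interval. So \<open>A + C\<close> is a closed convex subset of \<open>B\<close>
that reaches the same supporting lines, hence equals \<open>B\<close>.
\<close>

lemma mono_arc_length_diff_imp_summand:
  assumes A: "angle_recession \<theta> A" and B: "angle_recession \<theta> B"
    and mono: "mono_on {-\<theta><..<\<theta>} (\<lambda>t. arc_length_function B t - arc_length_function A t)"
  shows "is_summand A B"
proof -
  interpret A: angle_recession \<theta> A by fact
  interpret B: angle_recession \<theta> B by fact
  define C where "C = {x. \<forall>a\<in>A. x + a \<in> B}"
  define G where "G t = support_center B t - support_center A t" for t
  have C_eq: "C = (\<Inter>a\<in>A. (\<lambda>b. - a + b) ` B)"
    by (force simp: C_def image_iff algebra_simps)
  have "closed C" "convex C"
    unfolding C_eq
    by (intro closed_INT convex_INT ballI closed_translation convex_translation B.closed B.convex)+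
  have GC: "G t \<in> C" if t: "\<bar>t\<bar> < \<theta>" for t
  proof -
    have "G t + a \<in> B" if "a \<in> A" for a
    proof (rule ccontr)
      assume "G t + a \<notin> B"
      obtain T where T: "\<bar>T\<bar> < \<theta>" "\<And>b. b \<in> B \<Longrightarrow> direction T \<bullet> b < direction T \<bullet> (G t + a)"
        using separating_direction[OF B.\<theta> B.nonempty B.closed B.convex B.add_mem
            B.inner_le_support_center \<open>G t + a \<notin> B\<close>] B.\<theta> by auto
      have "direction T \<bullet> support_center B T < direction T \<bullet> (G t + a)"
        using T(2) B.support_center_in[OF T(1)] by blast
      moreover have "direction T \<bullet> a \<le> direction T \<bullet> support_center A T"
        using A.inner_le_support_center[OF T(1) that] .
      moreover have "direction T \<bullet> G t \<le> direction T \<bullet> G T"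
        unfolding G_def by (rule support_center_diff_maximal[OF A B mono t T(1)])
      ultimately show False
        by (simp add: G_def inner_add_right inner_diff_right)
    qed
    then show ?thesis by (simp add: C_def)
  qed
  have sub: "A + C \<subseteq> B"
    by (auto simp: set_plus_def C_def add.commute)
  obtain a0 where "a0 \<in> A" using A.nonempty by blast
  have "\<bar>0::real\<bar> < \<theta>" using A.\<theta> by simp
  have "C \<noteq> {}" using GC[OF \<open>\<bar>0\<bar> < \<theta>\<close>] by blast
  have "direction 0 \<bullet> c \<le> direction 0 \<bullet> support_center B 0 - direction 0 \<bullet> a0" if "c \<in> C" for c
    using B.inner_le_support_center[OF \<open>\<bar>0\<bar> < \<theta>\<close>, of "c + a0"] that \<open>a0 \<in> A\<close>
    by (simp add: C_def inner_add_right)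
  then have "closed (A + C)"
    by (rule A.closed_sum[OF \<open>closed C\<close>])
  have "B \<subseteq> A + C"
  proof (rule ccontr)
    assume "\<not> B \<subseteq> A + C"
    then obtain b where b: "b \<in> B" "b \<notin> A + C" by blast
    have "A + C \<noteq> {}"
      using \<open>a0 \<in> A\<close> \<open>C \<noteq> {}\<close> by (auto simp: set_plus_def)
    have add: "r *\<^sub>R direction \<phi> + x \<in> A + C"
      if x: "x \<in> A + C" and r: "0 \<le> r" "\<bar>\<phi> - pi\<bar> \<le> pi / 2 - \<theta>" for x r \<phi>
    proof -
      obtain a c where "x = a + c" "a \<in> A" "c \<in> C"
        using x by (auto simp: set_plus_def)
      then show ?thesis
        using A.add_mem[OF \<open>a \<in> A\<close> r] set_plus_intro[of "r *\<^sub>R direction \<phi> + a" A c C]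
        by (simp add: add.assoc)
    qed
    have le: "direction 0 \<bullet> x \<le> direction 0 \<bullet> support_center B 0" if "x \<in> A + C" for x
      using B.inner_le_support_center[OF \<open>\<bar>0\<bar> < \<theta>\<close>] sub that by blast
    obtain t where t: "\<bar>t\<bar> < \<theta>" "\<And>x. x \<in> A + C \<Longrightarrow> direction t \<bullet> x < direction t \<bullet> b"
      using separating_direction[OF A.\<theta> \<open>A + C \<noteq> {}\<close> \<open>closed (A + C)\<close>
          convex_set_plus[OF A.convex \<open>convex C\<close>] add le b(2)] by blast
    have "support_center A t + G t \<in> A + C"
      using A.support_center_in[OF t(1)] GC[OF t(1)] by (rule set_plus_intro)
    then have "direction t \<bullet> support_center B t < direction t \<bullet> b"
      using t(2) by (force simp: G_def)
    then show False
      using B.inner_le_support_center[OF t(1) b(1)] by simp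
  qed
  then show ?thesis
    unfolding is_summand_def using sub \<open>C \<noteq> {}\<close> \<open>closed C\<close> \<open>convex C\<close> by blast
qed

theorem proposition4p2:
  fixes \<theta> :: real and V A B :: "(real^2) set"
  assumes "0 < \<theta>" and "\<theta> \<le> pi / 2"
    and "V = left_angle \<theta>"
    and "A \<in> convex_sets_rec V" and "B \<in> convex_sets_rec V"
  shows "is_summand A B \<longleftrightarrow>
    mono_on {-\<theta><..<\<theta>} (\<lambda>t. arc_length_function B t - arc_length_function A t)"
proof
  have A: "angle_recession \<theta> A" and B: "angle_recession \<theta> B"
    using assms by (auto simp: angle_recession_def)
  show "is_summand A B" if
    "mono_on {-\<theta><..<\<theta>} (\<lambda>t. arc_length_function B t - arc_length_function A t)"
    using that by (rule mono_arc_length_diff_imp_summand[OF A B])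
  assume "is_summand A B"
  then obtain C where "B = A + C" "convex C"
    by (auto simp: is_summand_def)
  from summand_imp_mono_arc_length_diff[OF A B this]
  show "mono_on {-\<theta><..<\<theta>} (\<lambda>t. arc_length_function B t - arc_length_function A t)"
    by (intro mono_onI) auto
qed

end
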